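(* Let $n\ge 2$. A differential $(n-1)$-integrand $\Phi$ on $\mathbb{R}^n$ is projective if and only if it satisfies the equation $$\sum_{i=1}^n\frac{\partial^2\Phi}{\partial x_i\,\partial a_i}=0$$ (at all points $(\mathbf{x},a)$ with $a\neq 0$).
   Context: A parametric integrand of degree $k$ ($1\le k\le n$) on $\mathbb{R}^n$ is a continuous function $\Phi:\mathbb{R}^n\times\Lambda^k\mathbb{R}^n\to\mathbb{R}$ with $\Phi(\mathbf{x},ta)=t\,\Phi(\mathbf{x},a)$ for all $t>0$. It is called a differential $k$-integrand if it is smooth away from $\mathbb{R}^n\times\{0\}$. For an oriented $k$-dimensional submanifold $N\subset\mathbb{R}^n$, $\int_N\Phi$ is computed in positively oriented local parametrizations $\mathbf{r}(t_1,\dots,t_k)$ as $\int\Phi(\mathbf{r},\partial_{t_1}\mathbf{r}\wedge\cdots\wedge\partial_{t_k}\mathbf{r})\,dt_1\cdots dt_k$. A submanifold $N$ is an extremal of the functional $N\mapsto\int_N\Phi$ if the first variation vanishes for all smooth variations of $N$ that agree with $N$ outside a compact set. A differential $k$-integrand $\Phi$ is projective if all (oriented) $k$-dimensional affine subspaces of $\mathbb{R}^n$ are extremals of $N\mapsto\int_N\Phi$. Here $(x_1,\dots,x_n)$ are the standard coordinates on $\mathbb{R}^n$ and $(a_1,\dots,a_n)$ are the coordinates on $\Lambda^{n-1}\mathbb{R}^n$ with respect to the basis formed by the $(n-1)$-vectors $(-1)^{i-1}\mathbf{e}_1\wedge\cdots\wedge\widehat{\mathbf{e}_i}\wedge\cdots\wedge\mathbf{e}_n$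 ($1\le i\le n$), the hat denoting omission. *)

theory Defs
  imports "HOL-Analysis.Analysis"
begin

section \<open>The exterior power \<open>\<Lambda>\<^sup>k \<real>\<^sup>n\<close>\<close>

text \<open>
  Here \<open>n = CARD('n)\<close> and \<open>k = CARD('k)\<close>. A \<open>k\<close>-vector is given by its coordinates with respect
  to the basis of all \<open>e\<^bsub>i1\<^esub> \<and> \<dots> \<and> e\<^bsub>ik\<^esub>\<close> with \<open>I = {i1 < \<dots> < ik}\<close> a \<open>k\<close>-element set of
  indices; the type below is the span of these elements inside the whole exterior algebra of
  \<open>\<real>\<^sup>n\<close>, whose coordinates are indexed by all subsets of \<open>'n\<close>.
\<close>

typedef ('n::finite, 'k::finite) kvector =
  "{a :: real ^ ('n set). \<forall>I. card I \<noteq> CARD('k) \<longrightarrow> a $ I = 0}"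
  morphisms kcoords Abs_kvector
  by (rule exI [of _ 0]) simp

setup_lifting type_definition_kvector

instantiation kvector :: (finite, finite) real_vector
begin

lift_definition zero_kvector :: "('a, 'b) kvector" is 0 by simp

lift_definition plus_kvector :: "('a, 'b) kvector \<Rightarrow> ('a, 'b) kvector \<Rightarrow> ('a, 'b) kvector"
  is "(+)" by simp

lift_definition minus_kvector :: "('a, 'b) kvector \<Rightarrow> ('a, 'b) kvector \<Rightarrow> ('a, 'b) kvector"
  is "(-)" by simp

lift_definition uminus_kvector :: "('a, 'b) kvector \<Rightarrow> ('a, 'b) kvector"
  is uminus by simp

lift_definition scaleR_kvector :: "real \<Rightarrow> ('a, 'b) kvector \<Rightarrow> ('a, 'b) kvector"
  is "(*\<^sub>R)" by simp

instance
proof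
  fix a b c :: "('a, 'b) kvector" and r s :: real
  show "a + b + c = a + (b + c)" by transfer (simp add: add.assoc)
  show "a + b = b + a" by transfer (simp add: add.commute)
  show "0 + a = a" by transfer simp
  show "- a + a = 0" by transfer simp
  show "a - b = a + - b" by transfer simp
  show "r *\<^sub>R (a + b) = r *\<^sub>R a + r *\<^sub>R b" by transfer (simp add: scaleR_add_right)
  show "(r + s) *\<^sub>R a = r *\<^sub>R a + s *\<^sub>R a" by transfer (simp add: scaleR_add_left)
  show "r *\<^sub>R s *\<^sub>R a = (r * s) *\<^sub>R a" by transfer simp
  show "1 *\<^sub>R a = a" by transfer simp
qed

end

instantiation kvector :: (finite, finite) real_normed_vector
begin

lift_definition norm_kvector :: "('a, 'b) kvector \<Rightarrow> real" is norm .

definition dist_kvector :: "('a, 'b) kvector \<Rightarrow> ('a, 'b) kvector \<Rightarrow> real" where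
  "dist_kvector a b = norm (a - b)"

definition sgn_kvector :: "('a, 'b) kvector \<Rightarrow> ('a, 'b) kvector" where
  "sgn_kvector a = a /\<^sub>R norm a"

definition uniformity_kvector :: "(('a, 'b) kvector \<times> ('a, 'b) kvector) filter" where
  "uniformity_kvector = (INF e\<in>{0<..}. principal {(a, b). dist a b < e})"

definition open_kvector :: "('a, 'b) kvector set \<Rightarrow> bool" where
  "open_kvector U \<longleftrightarrow> (\<forall>a\<in>U. eventually (\<lambda>(a', b). a' = a \<longrightarrow> b \<in> U) uniformity)"

instance
proof
  fix a b :: "('a, 'b) kvector" and r :: real
  show "(norm a = 0) = (a = 0)" by transfer simp
  show "norm (a + b) \<le> norm a + norm b" by transfer (rule norm_triangle_ineq)
  show "norm (r *\<^sub>R a) = \<bar>r\<bar> * norm a" by transfer simp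
qed (simp_all add: dist_kvector_def sgn_kvector_def uniformity_kvector_def open_kvector_def)

end

text \<open>
  \<open>enum_set I j\<close> is the element of \<open>I\<close> whose position in \<open>I\<close> is that of \<open>j\<close> in \<open>'k\<close>; it is the
  increasing bijection \<open>'k \<rightarrow> I\<close> if \<open>card I = CARD('k)\<close>.
\<close>

definition enum_set :: "'n::{finite,linorder} set \<Rightarrow> 'k::{finite,linorder} \<Rightarrow> 'n" where
  "enum_set I j = sorted_list_of_set I ! card {..<j}"

text \<open>
  The coordinates of \<open>v\<^sub>1 \<and> \<dots> \<and> v\<^sub>k\<close> are the \<open>k \<times> k\<close> minors of the matrix of the \<open>v\<^sub>j\<close>.
\<close>

lift_definition wedge ::
  "('k::{finite,linorder} \<Rightarrow> real ^ 'n::{finite,linorder}) \<Rightarrow> ('n, 'k) kvector"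
  is "\<lambda>v. \<chi> I. if card I = CARD('k)
             then det ((\<chi> i j. v j $ enum_set I i) :: ((real, 'k) vec, 'k) vec) else 0"
  by simp

lemma enum_set_bij:
  fixes I :: "'n::{finite,linorder} set"
  assumes "card I = CARD('k::{finite,linorder})"
  shows "bij_betw (enum_set I :: 'k \<Rightarrow> 'n) UNIV I"
proof -
  have lt: "card {..<j} < CARD('k)" for j :: 'k
    by (rule psubset_card_mono) auto
  have inj: "inj (\<lambda>j::'k. card {..<j})"
  proof (rule linorder_injI)
    fix i j :: 'k assume "i < j"
    then have "{..<i} \<subset> {..<j}" by auto
    then show "card {..<i} \<noteq> card {..<j}" using psubset_card_mono [of "{..<j}" "{..<i}"] by simp
  qed
  have "inj (enum_set I :: 'k \<Rightarrow> 'n)"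
  proof (rule injI)
    fix i j :: 'k assume "enum_set I i = enum_set I j"
    then have "card {..<i} = card {..<j}"
      using lt [of i] lt [of j] assms
      by (simp add: enum_set_def nth_eq_iff_index_eq)
    with inj show "i = j" by (rule injD)
  qed
  moreover have "range (enum_set I :: 'k \<Rightarrow> 'n) \<subseteq> I"
  proof
    fix x assume "x \<in> range (enum_set I :: 'k \<Rightarrow> 'n)"
    then obtain j :: 'k where "x = sorted_list_of_set I ! card {..<j}"
      by (auto simp: enum_set_def)
    moreover have "card {..<j} < length (sorted_list_of_set I)" using lt [of j] assms by simp
    ultimately have "x \<in> set (sorted_list_of_set I)" by (metis nth_mem)
    then show "x \<in> I" by simp
  qed
  ultimately show ?thesis
    using assms by (metis bij_betw_def card_image card_subset_eq finite)
qed

lemma wedge_axis: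
  fixes I :: "'n::{finite,linorder} set"
  assumes I: "card I = CARD('k::{finite,linorder})"
  shows "kcoords (wedge (\<lambda>j::'k. axis (enum_set I j) 1)) = axis I 1"
proof -
  have "det ((\<chi> i j. axis (enum_set I j) 1 $ enum_set J i) :: ((real, 'k) vec, 'k) vec) = (if J = I then 1 else 0)"
    if J: "card J = CARD('k)" for J :: "'n set"
  proof (cases "J = I")
    case True
    have "(\<chi> i j. axis (enum_set I j) 1 $ enum_set I i) = (mat 1 :: ((real, 'k) vec, 'k) vec)"
      using enum_set_bij [OF I] by (auto simp: vec_eq_iff axis_def mat_def bij_betw_def inj_eq)
    with True show ?thesis by simp
  next
    case False
    then obtain x where x: "x \<in> J" "x \<notin> I"
      using I J by (metis card_subset_eq finite subsetI)
    then obtain i :: 'k where "x = enum_set J i"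
      using enum_set_bij [OF J] by (auto simp: bij_betw_def)
    moreover have "enum_set I j \<in> I" for j :: 'k
      using enum_set_bij [OF I] by (auto simp: bij_betw_def)
    ultimately have "row i ((\<chi> i j. axis (enum_set I j) 1 $ enum_set J i) :: ((real, 'k) vec, 'k) vec) = 0"
      using x by (auto simp: row_def vec_eq_iff axis_def)
    with False show ?thesis by (simp add: det_zero_row)
  qed
  then show ?thesis by (auto simp: wedge.rep_eq vec_eq_iff axis_def I)
qed

text \<open>
  For \<open>k = n - 1\<close>: the \<open>k\<close>-vector \<open>(-1)\<^sup>i\<^sup>-\<^sup>1 e\<^sub>1 \<and> \<dots> \<and> e\<^sub>n\<close> with \<open>e\<^sub>i\<close> omitted. The number
  \<open>i - 1\<close> is \<open>card {..<i}\<close>.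
\<close>

definition hyper_basis :: "'n::{finite,linorder} \<Rightarrow> ('n, 'k::{finite,linorder}) kvector" where
  "hyper_basis i = (-1) ^ card {..<i} *\<^sub>R wedge (\<lambda>j. axis (enum_set (UNIV - {i}) j) 1)"


section \<open>Smooth maps\<close>

definition dir_deriv ::
  "'a::real_normed_vector \<Rightarrow> ('a \<Rightarrow> 'b::real_normed_vector) \<Rightarrow> 'a \<Rightarrow> 'b" where
  "dir_deriv v f p = frechet_derivative f (at p) v"

text \<open>For open \<open>S\<close> in a finite-dimensional space this is the usual notion of class \<open>C\<^sup>m\<close>.\<close>

primrec Ck_on ::
  "nat \<Rightarrow> 'a::real_normed_vector set \<Rightarrow> ('a \<Rightarrow> 'b::real_normed_vector) \<Rightarrow> bool" where
  "Ck_on 0 S f \<longleftrightarrow> continuous_on S f"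
| "Ck_on (Suc m) S f \<longleftrightarrow>
     (\<forall>p\<in>S. f differentiable (at p)) \<and> (\<forall>v. Ck_on m S (dir_deriv v f))"

definition smooth_on ::
  "'a::real_normed_vector set \<Rightarrow> ('a \<Rightarrow> 'b::real_normed_vector) \<Rightarrow> bool" where
  "smooth_on S f \<longleftrightarrow> (\<forall>m. Ck_on m S f)"


section \<open>Parametric integrands\<close>

definition parametric_integrand ::
  "((real ^ 'n::finite) \<times> ('n, 'k::finite) kvector \<Rightarrow> real) \<Rightarrow> bool" where
  "parametric_integrand \<Phi> \<longleftrightarrow>
     continuous_on UNIV \<Phi> \<and> (\<forall>x a t. t > 0 \<longrightarrow> \<Phi> (x, t *\<^sub>R a) = t * \<Phi> (x, a))"

definition differential_integrand ::
  "((real ^ 'n::finite) \<times> ('n, 'k::finite) kvector \<Rightarrow> real) \<Rightarrow> bool" where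
  "differential_integrand \<Phi> \<longleftrightarrow>
     parametric_integrand \<Phi> \<and> smooth_on (- (UNIV \<times> {0})) \<Phi>"

text \<open>
  The integral of \<open>\<Phi>\<close> over the piece \<open>r ` K\<close> of the oriented submanifold with positively oriented
  parametrization \<open>r\<close>.
\<close>

definition integral_over ::
  "((real ^ 'n::{finite,linorder}) \<times> ('n, 'k::{finite,linorder}) kvector \<Rightarrow> real) \<Rightarrow>
   (real, 'k) vec set \<Rightarrow> ((real, 'k) vec \<Rightarrow> (real, 'n) vec) \<Rightarrow> real" where
  "integral_over \<Phi> K r = integral K (\<lambda>t. \<Phi> (r t, wedge (\<lambda>j. dir_deriv (axis j 1) r t)))"

text \<open>
  A smooth variation, with parameter \<open>s \<in> (-\<epsilon>, \<epsilon>)\<close>, of the submanifold parametrized by \<open>r\<close>, that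
  agrees with it outside the compact piece \<open>r ` K\<close>. The maps \<open>F (s, \<cdot>)\<close> are not required to be
  embeddings, since this is automatic for \<open>s\<close> near \<open>0\<close> if \<open>r\<close> is a closed embedding.
\<close>

definition smooth_variation ::
  "(real ^ 'k \<Rightarrow> real ^ 'n) \<Rightarrow> real \<Rightarrow> (real ^ 'k) set \<Rightarrow>
   (real \<times> (real ^ 'k) \<Rightarrow> real ^ 'n) \<Rightarrow> bool" where
  "smooth_variation r \<epsilon> K F \<longleftrightarrow>
     \<epsilon> > 0 \<and> compact K \<and> smooth_on ({-\<epsilon><..<\<epsilon>} \<times> UNIV) F \<and>
     (\<forall>t. F (0, t) = r t) \<and> (\<forall>s\<in>{-\<epsilon><..<\<epsilon>}. \<forall>t. t \<notin> K \<longrightarrow> F (s, t) = r t)"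

text \<open>
  The submanifold parametrized by \<open>r\<close> is an extremal. As the varied submanifolds agree outside
  \<open>r ` K\<close>, only the integral over the piece parametrized by \<open>K\<close> changes; the integral over the
  whole submanifold need not be finite.
\<close>

definition extremal ::
  "((real ^ 'n::{finite,linorder}) \<times> ('n, 'k::{finite,linorder}) kvector \<Rightarrow> real) \<Rightarrow>
   ((real, 'k) vec \<Rightarrow> (real, 'n) vec) \<Rightarrow> bool" where
  "extremal \<Phi> r \<longleftrightarrow>
     (\<forall>\<epsilon> K F. smooth_variation r \<epsilon> K F \<longrightarrow>
        ((\<lambda>s. integral_over \<Phi> K (\<lambda>t. F (s, t))) has_real_derivative 0) (at 0))"

text \<open>
  The maps \<open>t \<mapsto> p + L t\<close> with \<open>L\<close> linear and injective are exactly the affine parametrizations of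
  the \<open>k\<close>-dimensional affine subspaces. Each of the two orientations of a subspace is the one
  induced by some of them.
\<close>

definition projective ::
  "((real ^ 'n::{finite,linorder}) \<times> ('n, 'k::{finite,linorder}) kvector \<Rightarrow> real) \<Rightarrow> bool" where
  "projective \<Phi> \<longleftrightarrow>
     differential_integrand \<Phi> \<and>
     (\<forall>p (L :: (real, 'k) vec \<Rightarrow> (real, 'n) vec). linear L \<and> inj L \<longrightarrow> extremal \<Phi> (\<lambda>t. p + L t))"

end

(*
  For a variation F(s, t) of the hyperplane r(t) = p + L t with velocity V = dF/ds at s = 0,
  differentiation under the integral and integration by parts show that the first variation is
  the integral of the Euler-Lagrange expression
    D_x Phi (V) - sum_j d/dt_j [D_a Phi (v_1 ^ .. V .. ^ v_k)],   v_j = L e_j,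
  along r, with a = v_1 ^ .. ^ v_k constant. By homogeneity D_x Phi (V) is the x-derivative in
  direction V of D_a Phi (a), so only second derivatives of mixed type (x, a) occur. The adjugate
  identity for the n x n matrix with columns V, v_1, .., v_k turns the expression into
    det (V, v_1, .., v_k) * sum_i d^2 Phi / dx_i da_i.
  Hence the equation makes hyperplanes extremal. Conversely every nonzero (n-1)-vector a is
  v_1 ^ .. ^ v_k for some hyperplane, and testing with bump functions recovers the equation.
*)

theory Submission
  imports Defs
begin

section \<open>Multivectors of degree \<open>n - 1\<close>\<close>

text \<open>Two difficulties shape the proof. \<open>\<Phi>\<close> is smooth only where the
  multivector is nonzero, whereas a variation is arbitrary: differentiation under the integral is
  possible only for \<open>s\<close> near 0, where the varied tangent multivector stays nonzero over
  a whole box. And \<open>K\<close> is any compact set, so its boundary is of no use for integration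
  by parts: the integral is moved to a box containing \<open>K\<close>, outside of which the
  variation is trivial. Both implications are then read off from one formula,
  \<open>first_variation\<close>. Its factor sum_i V_i a_i, up to sign the determinant of V and the
  v_j, keeps the converse simple: a field in a single coordinate direction e_i with a_i nonzero is
  already transversal to the hyperplane, so one scalar bump function tests the equation. The index
  types are arbitrary finite linear orders, so V is put into an arbitrary slot \<open>i0\<close>
  among the columns, and the sign of that slot is carried along until it becomes a common factor in
  \<open>wedge_cramer\<close>.\<close>

definition hyper_coord ::
  "'n::{finite,linorder} \<Rightarrow> ('n, 'k::{finite,linorder}) kvector \<Rightarrow> real" where
  "hyper_coord i a = (-1) ^ card {..<i} * kcoords a $ (UNIV - {i})"

section \<open>Determinants and the order of the index type\<close>

lemma linear_det_column:
  fixes v :: "'k::finite \<Rightarrow> real ^ 'n" and f :: "'k \<Rightarrow> 'n::finite"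
  shows "linear (\<lambda>u. det ((\<chi> i j. (v(j0 := u)) j $ f i) :: ((real, 'k) vec, 'k) vec))"
proof -
  have eq: "det ((\<chi> i j. (v(j0 := u)) j $ f i) :: ((real, 'k) vec, 'k) vec) =
      det (\<chi> j. if j = j0 then (\<chi> i. u $ f i) else (\<chi> i. v j $ f i))" for u
    by (subst det_transpose [symmetric], rule arg_cong [of _ _ det])
      (simp add: transpose_def vec_eq_iff)
  have add: "(\<chi> i. (x + y) $ f i) = (\<chi> i. x $ f i) + (\<chi> i. y $ f i)" for x y :: "real ^ 'n"
    by (simp add: vec_eq_iff)
  have mul: "(\<chi> i. (r *\<^sub>R x) $ f i) = r *s (\<chi> i. x $ f i)" for r and x :: "real ^ 'n"
    by (simp add: vec_eq_iff)
  show ?thesis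
    by (rule linearI) (simp_all only: eq add mul det_row_add det_row_mul real_scaleR_def)
qed

text \<open>Column \<open>c\<close> replaced by \<open>axis q 1\<close> and row \<open>q\<close>
  replaced by \<open>axis c 1\<close> give the same cofactor. Hence the sum is the determinant with
  row \<open>q\<close> replaced by row \<open>p\<close>, which has two equal rows unless
  \<open>p = q\<close>.\<close>

lemma det_columns_adjugate:
  fixes w :: "'n::finite \<Rightarrow> real ^ 'n"
  shows "(\<Sum>c\<in>UNIV. w c $ p * det (\<chi> r d. (w(c := axis q 1)) d $ r)) =
    (if p = q then det (\<chi> r d. w d $ r) else 0)"
proof -
  have "det (\<chi> r d. (w(c := axis q 1)) d $ r) =
      det (\<chi> r. if r = q then axis c 1 else (\<chi> d. w d $ r))" for c
    unfolding det_def
  proof (intro sum.cong refl arg_cong2 [of _ _ _ _ "(*)"])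
    fix \<pi> :: "'n \<Rightarrow> 'n"
    assume "\<pi> \<in> {\<pi>. \<pi> permutes UNIV}"
    then have \<pi>: "bij \<pi>" by (simp add: permutes_bij)
    show "(\<Prod>i\<in>UNIV. (\<chi> r d. (w(c := axis q 1)) d $ r) $ i $ \<pi> i) =
        (\<Prod>i\<in>UNIV. (\<chi> r. if r = q then axis c 1 else (\<chi> d. w d $ r)) $ i $ \<pi> i)"
    \<comment> \<open>Term by term in the Leibniz formula: a permutation contributes to either
      determinant only if \<open>\<pi> q = c\<close>, and then the special factor is 1 in
      both.\<close>
    proof (cases "\<pi> q = c")
      case True
      with \<pi> show ?thesis by (intro prod.cong) (auto simp: axis_def bij_def inj_eq)
    next
      case False
      obtain r where "\<pi> r = c" using \<pi> by (metis bij_pointE)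
      with False have "(\<Prod>i\<in>UNIV. (\<chi> r d. (w(c := axis q 1)) d $ r) $ i $ \<pi> i) = 0"
        by (intro prod_zero) (auto simp: axis_def intro!: exI [of _ r])
      moreover have "(\<Prod>i\<in>UNIV. (\<chi> r. if r = q then axis c 1 else (\<chi> d. w d $ r)) $ i $ \<pi> i) = 0"
        using False by (intro prod_zero) (auto simp: axis_def intro!: exI [of _ q])
      ultimately show ?thesis by (simp only:)
    qed
  qed
  then have "(\<Sum>c\<in>UNIV. w c $ p * det (\<chi> r d. (w(c := axis q 1)) d $ r)) =
      (\<Sum>c\<in>UNIV. det (\<chi> r. if r = q then w c $ p *s axis c 1 else (\<chi> d. w d $ r)))"
    by (simp add: det_row_mul)
  also have "\<dots> = det (\<chi> r. if r = q then (\<Sum>c\<in>UNIV. w c $ p *s axis c 1) else (\<chi> d. w d $ r))"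
    by (simp add: det_linear_row_sum)
  also have "(\<Sum>c\<in>UNIV. w c $ p *s axis c 1) = (\<chi> d. w d $ p)"
    by (simp add: vec_eq_iff axis_def if_distrib [of "\<lambda>x. _ * x"] cong: if_cong)
  also have "det (\<chi> r. if r = q then (\<chi> d. w d $ p) else (\<chi> d. w d $ r)) =
      (if p = q then det (\<chi> r d. w d $ r) else 0)"
  proof (cases "p = q")
    case True
    then show ?thesis by (auto intro!: arg_cong [of _ _ det] simp: vec_eq_iff)
  next
    case False
    then show ?thesis
      by (simp, intro det_identical_rows [of p q]) (auto simp: row_def vec_eq_iff)
  qed
  finally show ?thesis .
qed

text \<open>Laplace expansion along the unit column \<open>i0\<close>. The minor has the index type
  \<open>'k\<close>, so its permutations are carried by \<open>map_permutation\<close> to those of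
  \<open>UNIV - {i0}\<close>, with the same sign.\<close>

lemma det_unit_column:
  fixes N :: "((real, 'n::finite) vec, 'n) vec" and \<beta> :: "'k::finite \<Rightarrow> 'n"
  assumes \<beta>: "bij_betw \<beta> UNIV (UNIV - {i0})"
    and N: "\<And>r. N $ r $ i0 = (if r = i0 then 1 else 0)"
  shows "det N = det ((\<chi> a b. N $ \<beta> a $ \<beta> b) :: ((real, 'k) vec, 'k) vec)"
proof -
  let ?m = "map_permutation UNIV \<beta>"
  have inj: "inj \<beta>" and im: "range \<beta> = UNIV - {i0}" using \<beta> by (auto simp: bij_betw_def)
  have app: "?m p (\<beta> a) = \<beta> (p a)" for p a
    using map_permutation_apply [of \<beta> UNIV a p] inj by simp
  have fixed: "?m p i0 = i0" for p
    by (simp add: map_permutation_def restrict_id_def im)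
  have "det N = (\<Sum>p | p permutes UNIV - {i0}. of_int (sign p) * (\<Prod>i\<in>UNIV. N $ i $ p i))"
    unfolding det_def
  proof (rule sum.mono_neutral_right)
    show "\<forall>p\<in>{p. p permutes UNIV} - {p. p permutes UNIV - {i0}}.
        of_int (sign p) * (\<Prod>i\<in>UNIV. N $ i $ p i) = 0"
    proof
      fix p assume p: "p \<in> {p. p permutes UNIV} - {p. p permutes UNIV - {i0}}"
      then have bij: "bij p" using permutes_bij by blast
      \<comment> \<open>Such a \<open>p\<close> sends some other row to column \<open>i0\<close>,
        where the entry is 0.\<close>
      have "p i0 \<noteq> i0"
        using p bij by (auto simp: permutes_def bij_iff)
      obtain r where "p r = i0" using bij by (metis bij_pointE)
      with \<open>p i0 \<noteq> i0\<close> have "r \<noteq> i0" by auto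
      with \<open>p r = i0\<close> have "N $ r $ p r = 0" by (simp add: N)
      then have "(\<Prod>i\<in>UNIV. N $ i $ p i) = 0"
        by (intro prod_zero) auto
      then show "of_int (sign p) * (\<Prod>i\<in>UNIV. N $ i $ p i) = 0" by simp
    qed
  qed (auto intro: permutes_subset)
  also have "\<dots> = (\<Sum>p | p permutes (UNIV :: 'k set).
      of_int (sign (?m p)) * (\<Prod>i\<in>UNIV. N $ i $ ?m p i))"
  proof (rule sum.reindex_bij_betw [symmetric])
    have "?m = (\<lambda>\<pi> x. if x \<in> UNIV - {i0} then \<beta> (\<pi> (inv_into UNIV \<beta> x)) else x)"
      by (auto simp: fun_eq_iff map_permutation_def restrict_id_def im)
    with bij_betw_permutations [OF \<beta>]
    show "bij_betw ?m {p. p permutes UNIV} {p. p permutes UNIV - {i0}}" by simp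
  qed
  also have "\<dots> = (\<Sum>p | p permutes (UNIV :: 'k set).
      of_int (sign p) * (\<Prod>i\<in>UNIV. (\<chi> a b. N $ \<beta> a $ \<beta> b) $ i $ p i))"
  proof (rule sum.cong [OF refl])
    fix p :: "'k \<Rightarrow> 'k" assume "p \<in> {p. p permutes UNIV}"
    then have s: "sign (?m p) = sign p" using inj by (simp add: sign_map_permutation)
    have "(\<Prod>i\<in>UNIV. N $ i $ ?m p i) = N $ i0 $ ?m p i0 * (\<Prod>i\<in>UNIV - {i0}. N $ i $ ?m p i)"
      by (rule prod.remove) auto
    also have "\<dots> = (\<Prod>a\<in>UNIV. N $ \<beta> a $ \<beta> (p a))"
      using prod.reindex_bij_betw [OF \<beta>, of "\<lambda>i. N $ i $ ?m p i"] by (simp add: fixed N app)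
    finally show "of_int (sign (?m p)) * (\<Prod>i\<in>UNIV. N $ i $ ?m p i) =
        of_int (sign p) * (\<Prod>i\<in>UNIV. (\<chi> a b. N $ \<beta> a $ \<beta> b) $ i $ p i)"
      by (simp add: s)
  qed
  also have "\<dots> = det ((\<chi> a b. N $ \<beta> a $ \<beta> b) :: ((real, 'k) vec, 'k) vec)"
    by (simp add: det_def)
  finally show ?thesis .
qed

text \<open>\<open>adj\<close> says that \<open>i'\<close> is the successor of \<open>i\<close>. No
  index lies between them, so exchanging them is monotone on \<open>UNIV - {i}\<close> and maps one
  sorted list to the other.\<close>

lemma enum_set_adjacent:
  fixes i i' :: "'n::{finite,linorder}" and j :: "'k::{finite,linorder}"
  assumes card: "CARD('n) = Suc CARD('k)" and adj: "{..<i'} = insert i {..<i}"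
  shows "enum_set (UNIV - {i'}) j = Transposition.transpose i i' (enum_set (UNIV - {i}) j)"
proof -
  let ?t = "Transposition.transpose i i'" and ?l = "sorted_list_of_set (UNIV - {i})"
  have less: "x < i' \<longleftrightarrow> x = i \<or> x < i" for x using adj by auto
  then have "i < i'" by blast
  have mono: "?t x < ?t y" if "x < y" "x \<noteq> i" "y \<noteq> i" for x y
    using that less [of x] less [of y] \<open>i < i'\<close>
    by (auto simp: Transposition.transpose_def)
  have "sorted_wrt (<) (map ?t ?l)"
    unfolding sorted_wrt_map
    by (rule sorted_wrt_mono_rel [OF _ strict_sorted_list_of_set]) (auto intro: mono)
  moreover have "set (map ?t ?l) = UNIV - {i'}"
    using \<open>i < i'\<close> by (auto simp: image_def Transposition.transpose_def)
  ultimately have "map ?t ?l = sorted_list_of_set (UNIV - {i'})"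
    by (intro sorted_distinct_set_unique) (auto simp: strict_sorted_iff)
  moreover have "card {..<j} < length ?l"
    using psubset_card_mono [of UNIV "{..<j}"] card by auto
  ultimately show ?thesis
    by (metis enum_set_def nth_map)
qed

text \<open>Descends from \<open>i\<close> to the least element, one predecessor at a time; the
  predecessor is the maximum of \<open>{..<i}\<close>.\<close>

lemma const_if_adjacent_const:
  fixes f :: "'n::{finite,linorder} \<Rightarrow> 'b"
  assumes adj: "\<And>i i'. {..<i'} = insert i {..<i} \<Longrightarrow> f i' = f i"
  shows "f i = f j"
proof -
  have "f i = f (Min UNIV)" for i
  proof (induction "card {..<i}" arbitrary: i rule: less_induct)
    case less
    show ?case
    proof (cases "{..<i} = {}")
      case True
      then have "i = Min UNIV"
        by (intro Min_eqI [symmetric]) (auto simp: set_eq_iff not_less)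
      then show ?thesis by simp
    next
      case False
      define m where "m = Max {..<i}"
      have "m \<in> {..<i}" unfolding m_def by (rule Max_in) (use False in auto)
      then have "m < i" by simp
      have le: "x \<le> m" if "x < i" for x unfolding m_def by (rule Max_ge) (use that in auto)
      have eq: "{..<i} = insert m {..<m}" using le \<open>m < i\<close> by force
      then have "card {..<m} < card {..<i}" by (intro psubset_card_mono) auto
      from less [OF this] adj [OF eq] show ?thesis by simp
    qed
  qed
  then show ?thesis by metis
qed


section \<open>Coordinates of wedge products as determinants of square matrices\<close>

lemma hyper_coord_wedge_minor:
  fixes v :: "'k::{finite,linorder} \<Rightarrow> real ^ 'n::{finite,linorder}"
  assumes "CARD('n) = Suc CARD('k)"
  shows "hyper_coord i (wedge v) =
    (-1) ^ card {..<i} * det ((\<chi> a b. v b $ enum_set (UNIV - {i}) a) :: ((real, 'k) vec, 'k) vec)"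
  using assms by (simp add: hyper_coord_def wedge.rep_eq)

text \<open>A square matrix needs columns indexed by \<open>'n\<close>, while \<open>v\<close> is
  indexed by \<open>'k\<close>; the inverse of the increasing enumeration moves \<open>v\<close> to
  the slots other than \<open>i0\<close>.\<close>

definition frame ::
  "'n::{finite,linorder} \<Rightarrow> (real, 'n) vec \<Rightarrow> ('k::{finite,linorder} \<Rightarrow> (real, 'n) vec) \<Rightarrow> 'n \<Rightarrow> (real, 'n) vec" where
  "frame i0 u v c = (if c = i0 then u else v (inv (enum_set (UNIV - {i0})) c))"

lemma bij_enum_set_hyper:
  assumes "CARD('n::{finite,linorder}) = Suc CARD('k::{finite,linorder})"
  shows "bij_betw (enum_set (UNIV - {i}) :: 'k \<Rightarrow> 'n) UNIV (UNIV - {i})"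
  using assms by (intro enum_set_bij) simp

lemma frame_simps:
  fixes i0 :: "'n::{finite,linorder}" and u :: "(real, 'n::{finite,linorder}) vec" and v :: "'k::{finite,linorder} \<Rightarrow> (real, 'n) vec"
  assumes card: "CARD('n) = Suc CARD('k)"
  defines "\<beta> \<equiv> enum_set (UNIV - {i0}) :: 'k \<Rightarrow> 'n"
  shows "frame i0 u v i0 = u" "frame i0 u v (\<beta> j) = v j"
    "(frame i0 u v)(i0 := x) = frame i0 x v"
    "(frame i0 u v)(\<beta> j := x) = frame i0 u (v(j := x))"
proof -
  have inj: "inj \<beta>" and im: "range \<beta> = UNIV - {i0}"
    using bij_enum_set_hyper [OF card, of i0] by (auto simp: \<beta>_def bij_betw_def)
  have ne: "\<beta> j \<noteq> i0" for j using im by blast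
  have eq: "\<beta> (inv \<beta> c) = c" if "c \<noteq> i0" for c using im that by (auto intro: f_inv_into_f)
  show "frame i0 u v i0 = u" by (simp add: frame_def)
  show "frame i0 u v (\<beta> j) = v j" using inj ne by (simp add: frame_def flip: \<beta>_def)
  show "(frame i0 u v)(i0 := x) = frame i0 x v" by (auto simp: frame_def)
  show "(frame i0 u v)(\<beta> j := x) = frame i0 u (v(j := x))"
    using ne [of j] eq inj by (auto simp: frame_def fun_eq_iff simp flip: \<beta>_def)
qed

text \<open>
  The permutation \<open>q i\<close> of the rows that moves row \<open>i\<close> to place \<open>i0\<close> and keeps the others in order
  changes by a transposition when \<open>i\<close> is replaced by its successor; this produces the signs.
\<close>

lemma hyper_coord_wedge:
  fixes v :: "'k::{finite,linorder} \<Rightarrow> (real, 'n::{finite,linorder}) vec"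
  assumes card: "CARD('n) = Suc CARD('k)"
  shows "hyper_coord i (wedge v) =
    (-1) ^ card {..<i0} * det (\<chi> r c. frame i0 (axis i 1) v c $ r)"
proof -
  define \<beta> :: "'k \<Rightarrow> 'n" where "\<beta> = enum_set (UNIV - {i0})"
  define q :: "'n \<Rightarrow> 'n \<Rightarrow> 'n" where
    "q i r = (if r = i0 then i else enum_set (UNIV - {i}) (inv \<beta> r))" for i r
  have \<beta>: "bij_betw \<beta> UNIV (UNIV - {i0})"
    unfolding \<beta>_def by (rule bij_enum_set_hyper [OF card])
  then have inj: "inj \<beta>" and im: "range \<beta> = UNIV - {i0}" by (auto simp: bij_betw_def)
  have ne: "\<beta> j \<noteq> i0" for j using im by blast
  have eq: "\<beta> (inv \<beta> c) = c" if "c \<noteq> i0" for c using im that by (auto intro: f_inv_into_f)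
  have q\<beta>: "q i (\<beta> j) = enum_set (UNIV - {i}) j" for i j
    using inj ne by (simp add: q_def)
  have enum_ne: "enum_set (UNIV - {i}) (j :: 'k) \<noteq> i" for i :: 'n and j
    using bij_enum_set_hyper [OF card, of i] by (auto simp: bij_betw_def)
  have "inj (q i)" for i
  proof (rule injI)
    fix r s assume rs: "q i r = q i s"
    have inj_enum: "inj (enum_set (UNIV - {i}) :: 'k \<Rightarrow> 'n)"
      using bij_enum_set_hyper [OF card, of i] by (auto simp: bij_betw_def)
    show "r = s"
    proof (cases "r = i0 \<or> s = i0")
      case True
      with rs show ?thesis using enum_ne [of i] enum_ne [of i, symmetric]
        by (auto simp: q_def split: if_splits)
    next
      case False
      with rs have "inv \<beta> r = inv \<beta> s" by (simp add: q_def inj_eq [OF inj_enum])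
      with False show ?thesis using eq by metis
    qed
  qed
  then have q: "q i permutes UNIV" for i
    by (intro bij_imp_permutes) (auto simp: bij_def finite_UNIV_inj_surj)
  have "sign (q i') * (-1) ^ card {..<i'} = sign (q i) * (-1) ^ card {..<i}"
    if adj: "{..<i'} = insert i {..<i}" for i i'
  proof -
    have "i < i'" using adj by blast
    have q': "q i' = Transposition.transpose i i' \<circ> q i"
      using enum_set_adjacent [OF card adj] by (auto simp: q_def fun_eq_iff)
    have "permutation (q i)" unfolding permutation_permutes using q [of i] finite by blast
    then have "sign (q i') = sign (Transposition.transpose i i') * sign (q i)"
      unfolding q' by (rule sign_compose [OF permutation_swap_id])
    also have "sign (Transposition.transpose i i') = - 1"
      using \<open>i < i'\<close> by (simp add: sign_swap_id)
    finally have "sign (q i') = - sign (q i)" by simp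
    moreover have "card {..<i'} = Suc (card {..<i})" unfolding adj by simp
    ultimately show ?thesis by (simp only: power_Suc)
  qed
  then have "sign (q i) * (-1) ^ card {..<i} = sign (q i0) * (-1) ^ card {..<i0}"
    by (rule const_if_adjacent_const)
  moreover have "q i0 = id" using eq by (auto simp: q_def fun_eq_iff simp flip: \<beta>_def)
  ultimately have sgn: "sign (q i) * (-1) ^ card {..<i} = (-1) ^ card {..<i0}" by simp
  have fr: "frame i0 u v (\<beta> b) = v b" for u b
    unfolding \<beta>_def by (rule frame_simps [OF card])
  define A where "A = (\<chi> r c. frame i0 (axis i 1) v c $ r)"
  \<comment> \<open>The rows are permuted so that column \<open>i0\<close>, which is
    \<open>axis i 1\<close>, becomes the unit column that \<open>det_unit_column\<close>
    expects.\<close>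
  have "of_int (sign (q i)) * det A = det (\<chi> r. A $ q i r)"
    using det_permute_rows [OF q [of i], of A] by simp
  also have "\<dots> = det ((\<chi> a b. (\<chi> r. A $ q i r) $ \<beta> a $ \<beta> b) :: ((real, 'k) vec, 'k) vec)"
    using q [of i]
    by (intro det_unit_column [OF \<beta>])
      (auto simp: A_def frame_def axis_def q_def enum_ne)
  also have "\<dots> = det ((\<chi> a b. v b $ enum_set (UNIV - {i}) a) :: ((real, 'k) vec, 'k) vec)"
    by (simp add: A_def q\<beta> fr)
  finally have "hyper_coord i (wedge v) =
      of_int (sign (q i) * (-1) ^ card {..<i}) * det A"
    by (simp add: hyper_coord_wedge_minor [OF card])
  then show ?thesis unfolding sgn by (simp add: A_def)
qed

text \<open>By \<open>hyper_coord_wedge\<close> the right side is, up to the sign of the slot, the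
  pairing of \<open>u\<close> with the coordinates of \<open>wedge v\<close>.\<close>

lemma det_frame_linear:
  fixes v :: "'k::{finite,linorder} \<Rightarrow> (real, 'n::{finite,linorder}) vec"
  assumes card: "CARD('n) = Suc CARD('k)"
  shows "det (\<chi> r c. frame i0 u v c $ r) =
    (\<Sum>i\<in>UNIV. u $ i * det (\<chi> r c. frame i0 (axis i 1) v c $ r))"
proof -
  have "linear (\<lambda>u. det (\<chi> r c. ((frame i0 0 v)(i0 := u)) c $ r))"
    by (rule linear_det_column [of "frame i0 0 v" i0 "\<lambda>i. i"])
  then have lin: "linear (\<lambda>u. det (\<chi> r c. frame i0 u v c $ r))"
    by (simp only: frame_simps [OF card])
  have "det (\<chi> r c. frame i0 u v c $ r) = det (\<chi> r c. frame i0 (\<Sum>i\<in>UNIV. u $ i *\<^sub>R axis i 1) v c $ r)"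
    by (simp only: basis_expansion flip: scalar_mult_eq_scaleR)
  also have "\<dots> = (\<Sum>i\<in>UNIV. u $ i * det (\<chi> r c. frame i0 (axis i 1) v c $ r))"
    by (simp only: linear_sum [OF lin] linear_cmul [OF lin] real_scaleR_def)
  finally show ?thesis .
qed

text \<open>Source of the minus sign in \<open>wedge_cramer\<close>: the slot \<open>i0\<close> and
  the slot of \<open>v j\<close> are exchanged.\<close>

lemma det_frame_swap:
  fixes v :: "'k::{finite,linorder} \<Rightarrow> (real, 'n::{finite,linorder}) vec"
  assumes card: "CARD('n) = Suc CARD('k)"
  shows "det (\<chi> r c. frame i0 u (v(j := x)) c $ r) = - det (\<chi> r c. frame i0 x (v(j := u)) c $ r)"
proof -
  define b where "b = enum_set (UNIV - {i0}) j"
  define A where "A = (\<chi> r c. frame i0 x (v(j := u)) c $ r)"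
  let ?t = "Transposition.transpose i0 b"
  have b: "b \<noteq> i0" using bij_enum_set_hyper [OF card, of i0] by (auto simp: bij_betw_def b_def)
  have "(frame i0 u (v(j := x)) :: 'n \<Rightarrow> _) = (frame i0 0 v)(i0 := u, b := x)"
    unfolding b_def by (simp add: frame_simps [OF card])
  moreover have "(frame i0 x (v(j := u)) :: 'n \<Rightarrow> _) = (frame i0 0 v)(i0 := x, b := u)"
    unfolding b_def by (simp add: frame_simps [OF card])
  ultimately have "(\<chi> r c. frame i0 u (v(j := x)) c $ r) = (\<chi> r c. A $ r $ ?t c)"
    using b by (auto simp: A_def vec_eq_iff Transposition.transpose_def)
  then show ?thesis
    using det_permute_columns [OF permutes_swap_id [of i0 UNIV b], of A] b
    by (simp add: sign_swap_id A_def)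
qed

text \<open>
  For \<open>k = n - 1\<close> this is the coordinate form of
  \<open>u \<otimes> (v\<^sub>1 \<and> \<dots> \<and> v\<^sub>k) - \<Sum>\<^sub>j v\<^sub>j \<otimes> (v\<^sub>1 \<and> \<dots> u \<dots> \<and> v\<^sub>k) = det (u, v\<^sub>1, \<dots>, v\<^sub>k) \<Sum>\<^sub>i e\<^sub>i \<otimes> b\<^sub>i\<close>
  with \<open>b\<^sub>i = hyper_basis i\<close>; it is \<open>M adj(M) = det(M) I\<close> for the matrix with
  columns \<open>u, v\<^sub>1, \<dots>, v\<^sub>k\<close>.
\<close>

lemma wedge_cramer:
  fixes v :: "'k::{finite,linorder} \<Rightarrow> (real, 'n::{finite,linorder}) vec"
  assumes card: "CARD('n) = Suc CARD('k)"
  shows "u $ p * hyper_coord q (wedge v) - (\<Sum>j\<in>UNIV. v j $ p * hyper_coord q (wedge (v(j := u)))) =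
    (if p = q then \<Sum>i\<in>UNIV. u $ i * hyper_coord i (wedge v) else 0)"
proof -
  define i0 :: 'n where "i0 = p"
  define D where "D x w = det (\<chi> r c. frame i0 x w c $ r)" for x and w :: "'k \<Rightarrow> (real, 'n) vec"
  define s :: real where "s = (-1) ^ card {..<i0}"
  define \<beta> :: "'k \<Rightarrow> 'n" where "\<beta> = enum_set (UNIV - {i0})"
  let ?f = "\<lambda>c. frame i0 u v c $ p * det (\<chi> r d. ((frame i0 u v)(c := axis q 1)) d $ r)"
  have hc: "hyper_coord i (wedge w) = s * D (axis i 1) w" for i w
    unfolding s_def D_def by (rule hyper_coord_wedge [OF card])
  \<comment> \<open>The columns in the adjugate sum are \<open>u\<close> in slot \<open>i0\<close>,
    which gives the leading term, and the \<open>v j\<close>, which give the sum over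
    \<open>j\<close>.\<close>
  have "(if p = q then D u v else 0) = (\<Sum>c\<in>UNIV. ?f c)"
    unfolding D_def by (rule det_columns_adjugate [symmetric])
  also have "\<dots> = ?f i0 + (\<Sum>c\<in>UNIV - {i0}. ?f c)"
    by (rule sum.remove) auto
  also have "(\<Sum>c\<in>UNIV - {i0}. ?f c) = (\<Sum>j\<in>UNIV. ?f (\<beta> j))"
    by (rule sum.reindex_bij_betw [symmetric]) (simp add: \<beta>_def bij_enum_set_hyper [OF card])
  \<comment> \<open>Once \<open>axis q 1\<close> has replaced \<open>v j\<close>, exchanging it with
    \<open>u\<close> brings it into slot \<open>i0\<close>, as in \<open>hc\<close>.\<close>
  also have "\<dots> = - (\<Sum>j\<in>UNIV. v j $ p * D (axis q 1) (v(j := u)))"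
    unfolding \<beta>_def D_def
    by (simp add: frame_simps [OF card] det_frame_swap [OF card, of _ u] sum_negf)
  also have "?f i0 = u $ p * D (axis q 1) v"
    by (simp add: D_def frame_simps [OF card])
  finally have "u $ p * D (axis q 1) v - (\<Sum>j\<in>UNIV. v j $ p * D (axis q 1) (v(j := u))) =
      (if p = q then D u v else 0)" by (simp add: fun_upd_def)
  from arg_cong [OF this, of "\<lambda>x. s * x"] show ?thesis
    unfolding hc det_frame_linear [OF card, of i0 u v, folded D_def]
    by (simp add: right_diff_distrib sum_distrib_left mult.left_commute if_distrib cong: if_cong)
qed

section \<open>Coordinates on the (n-1)-vectors, nonvanishing and decomposability\<close>

lemma linear_kcoords: "linear kcoords"
  by (rule linearI) (simp_all add: plus_kvector.rep_eq scaleR_kvector.rep_eq)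

lemma linear_hyper_coord: "linear (hyper_coord i)"
  by (rule linearI)
    (simp_all add: hyper_coord_def plus_kvector.rep_eq scaleR_kvector.rep_eq distrib_left)

lemma hyper_coord_0 [simp]: "hyper_coord i 0 = 0"
  by (rule linear_0 [OF linear_hyper_coord])

lemma linear_wedge:
  fixes v :: "'k::{finite,linorder} \<Rightarrow> (real, 'n::{finite,linorder}) vec"
  shows "linear (\<lambda>u. wedge (v(j := u)))"
proof (rule linearI; rule kcoords_inject [THEN iffD1]; rule vec_eq_iff [THEN iffD2], rule allI)
  fix x y and I :: "'n set"
  show "kcoords (wedge (v(j := x + y))) $ I = kcoords (wedge (v(j := x)) + wedge (v(j := y))) $ I"
    using linear_add [OF linear_det_column [of v j "enum_set I"], of x y]
    by (simp add: wedge.rep_eq plus_kvector.rep_eq del: fun_upd_apply)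
next
  fix r x and I :: "'n set"
  show "kcoords (wedge (v(j := r *\<^sub>R x))) $ I = kcoords (r *\<^sub>R wedge (v(j := x))) $ I"
    using linear_cmul [OF linear_det_column [of v j "enum_set I"], of r x]
    by (simp add: wedge.rep_eq scaleR_kvector.rep_eq del: fun_upd_apply)
qed

lemma wedge_identical:
  assumes "i \<noteq> j" "v i = v j"
  shows "wedge v = 0"
proof -
  have "det (\<chi> a b. v b $ enum_set I a) = 0" for I
    using assms by (intro det_identical_columns [of i j]) (auto simp: column_def)
  then show ?thesis
    by (subst kcoords_inject [symmetric]) (simp add: vec_eq_iff wedge.rep_eq zero_kvector.rep_eq)
qed

text \<open>The \<open>k\<close>-element index sets are exactly the complements of single indices,
  and the sign in \<open>hyper_coord\<close> cancels the one in \<open>hyper_basis\<close>.\<close>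

lemma hyper_expansion:
  fixes a :: "('n::{finite,linorder}, 'k::{finite,linorder}) kvector"
  assumes card: "CARD('n) = Suc CARD('k)"
  shows "a = (\<Sum>i\<in>UNIV. hyper_coord i a *\<^sub>R hyper_basis i)"
proof -
  have basis: "kcoords (hyper_basis i :: ('n, 'k) kvector) = (-1) ^ card {..<i} *\<^sub>R axis (UNIV - {i}) 1"
    for i
    using card by (simp add: hyper_basis_def scaleR_kvector.rep_eq wedge_axis)
  have "kcoords a $ I = (\<Sum>i\<in>UNIV. hyper_coord i a *\<^sub>R kcoords (hyper_basis i :: ('n, 'k) kvector)) $ I" for I
  proof (cases "card I = CARD('k)")
    case True
    then have "card (- I) = 1" using card by (simp add: Compl_eq_Diff_UNIV card_Diff_subset)
    then obtain i where "- I = {i}" by (rule card_1_singletonE)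
    then have I: "I = UNIV - {i}" by blast
    have "(\<Sum>i'\<in>UNIV. hyper_coord i' a *\<^sub>R kcoords (hyper_basis i' :: ('n, 'k) kvector)) $ I =
        (\<Sum>i'\<in>UNIV. if i' = i then kcoords a $ I else 0)"
      unfolding sum_component
    proof (rule sum.cong [OF refl])
      fix i'
      have "UNIV - {i} = UNIV - {i'} \<longleftrightarrow> i' = i" by blast
      then show "(hyper_coord i' a *\<^sub>R kcoords (hyper_basis i' :: ('n, 'k) kvector)) $ I =
          (if i' = i then kcoords a $ I else 0)"
        by (auto simp: basis hyper_coord_def axis_def I simp flip: power_mult_distrib mult.assoc)
    qed
    then show ?thesis by simp
  next
    case False
    then have "I \<noteq> UNIV - {i}" for i :: 'n using card by auto
    with False kcoords [of a] show ?thesis by (simp add: basis axis_def sum_component)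
  qed
  then show ?thesis
    by (subst kcoords_inject [symmetric])
      (simp add: vec_eq_iff linear_sum [OF linear_kcoords] linear_cmul [OF linear_kcoords])
qed

lemma hyper_coord_eqI:
  fixes a :: "('n::{finite,linorder}, 'k::{finite,linorder}) kvector"
  assumes "CARD('n) = Suc CARD('k)" "\<And>i. hyper_coord i a = hyper_coord i b"
  shows "a = b"
  by (subst (1 2) hyper_expansion [OF assms(1)]) (simp add: assms(2))

lemma det_nz_iff_inj_mult:
  fixes A :: "((real, 'n::finite) vec, 'n) vec"
  shows "det A \<noteq> 0 \<longleftrightarrow> inj ((*v) A)"
  using det_nz_iff_inj [OF matrix_vector_mul_linear, of A] by simp

text \<open>A vector \<open>u\<close> outside the range of \<open>L\<close> completes the
  \<open>v j\<close> to a basis, so the frame has nonzero determinant; but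
  \<open>det_frame_linear\<close> writes this determinant in terms of the coordinates of the
  wedge.\<close>

lemma wedge_nonzero:
  fixes L :: "(real, 'k::{finite,linorder}) vec \<Rightarrow> (real, 'n::{finite,linorder}) vec"
  assumes card: "CARD('n) = Suc CARD('k)" and L: "linear L" "inj L"
  shows "wedge (\<lambda>j. L (axis j 1)) \<noteq> 0"
proof
  define v where "v j = L (axis j 1)" for j
  assume "wedge (\<lambda>j. L (axis j 1)) = 0"
  then have "wedge v = 0" by (simp add: v_def [abs_def])
  define i0 :: 'n where "i0 = undefined"
  have "dim (range L) = CARD('k)"
    using L by (simp add: dim_image_eq)
  then have "range L \<noteq> UNIV" using card by (metis DIM_cart DIM_real dim_UNIV mult_1_right n_not_Suc_n)
  then obtain u where u: "u \<notin> range L" by blast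
  define A where "A = (\<chi> r c. frame i0 u v c $ r)"
  have "inj ((*v) A)"
  proof (rule linear_injective_0 [THEN iffD2]; safe?)
    fix x assume x: "A *v x = 0"
    define y where "y = (\<chi> j. x $ enum_set (UNIV - {i0}) (j :: 'k))"
    have "A *v x = (\<Sum>c\<in>UNIV. x $ c *\<^sub>R frame i0 u v c)"
      by (simp add: A_def vec_eq_iff matrix_vector_mult_def mult.commute)
    also have "\<dots> = x $ i0 *\<^sub>R u + (\<Sum>c\<in>UNIV - {i0}. x $ c *\<^sub>R frame i0 u v c)"
      by (subst sum.remove [of _ i0]) (simp_all add: frame_simps [OF card])
    also have "(\<Sum>c\<in>UNIV - {i0}. x $ c *\<^sub>R frame i0 u v c) = (\<Sum>j\<in>UNIV. y $ j *\<^sub>R v j)"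
      by (subst sum.reindex_bij_betw [OF bij_enum_set_hyper [OF card], symmetric])
        (simp add: frame_simps [OF card] y_def)
    also have "\<dots> = L (\<Sum>j\<in>UNIV. y $ j *\<^sub>R axis j 1)"
      by (simp add: v_def linear_sum [OF L(1)] linear_cmul [OF L(1)])
    also have "(\<Sum>j\<in>UNIV. y $ j *\<^sub>R axis j 1) = y"
      by (simp only: basis_expansion flip: scalar_mult_eq_scaleR)
    finally have eq: "x $ i0 *\<^sub>R u + L y = 0" using x by simp
    have "x $ i0 = 0"
    proof (rule ccontr)
      assume "x $ i0 \<noteq> 0"
      then have "u = (1 / x $ i0) *\<^sub>R (x $ i0 *\<^sub>R u)" by simp
      also have "x $ i0 *\<^sub>R u = - L y" using eq by (simp add: eq_neg_iff_add_eq_0)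
      also have "(1 / x $ i0) *\<^sub>R (- L y) = L (- (1 / x $ i0) *\<^sub>R y)"
        by (simp add: linear_cmul [OF L(1)] linear_neg [OF L(1)])
      finally show False using u by blast
    qed
    with eq have "L y = 0" by simp
    then have "y = 0" using L by (metis injD linear_0)
    have "x $ c = 0" for c
    proof (cases "c = i0")
      case False
      then obtain j :: 'k where "c = enum_set (UNIV - {i0}) j"
        using bij_enum_set_hyper [OF card, of i0] by (auto simp: bij_betw_def image_iff set_eq_iff)
      with \<open>y = 0\<close> show ?thesis by (simp add: y_def vec_eq_iff)
    qed (use \<open>x $ i0 = 0\<close> in simp)
    then show "x = 0" by (simp add: vec_eq_iff)
  qed simp
  then have "det A \<noteq> 0" by (simp add: det_nz_iff_inj_mult)
  moreover have "det (\<chi> r c. frame i0 (axis i 1) v c $ r) = 0" for i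
    using hyper_coord_wedge [OF card, of i v i0] \<open>wedge v = 0\<close>
    by simp
  ultimately show False unfolding A_def det_frame_linear [OF card, of i0 u v] by simp
qed

text \<open>Take \<open>u = v l\<close> in \<open>wedge_cramer\<close> on the diagonal
  \<open>p = q\<close>: the terms with \<open>j \<noteq> l\<close> contain a repeated vector, and
  the term \<open>j = l\<close> cancels the leading one.\<close>

lemma wedge_orthogonal:
  fixes v :: "'k::{finite,linorder} \<Rightarrow> (real, 'n::{finite,linorder}) vec"
  assumes card: "CARD('n) = Suc CARD('k)"
  shows "(\<Sum>i\<in>UNIV. v l $ i * hyper_coord i (wedge v)) = 0"
proof -
  have "hyper_coord q (wedge (v(j := v l))) = (if j = l then hyper_coord q (wedge v) else 0)" for j q
    by (simp add: wedge_identical [of j l])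
  then show ?thesis using wedge_cramer [OF card, of "v l" undefined undefined v]
    by (simp add: if_distrib [of "\<lambda>x. _ * x"] cong: if_cong)
qed

text \<open>
  With \<open>\<alpha>\<close> the coordinates of \<open>a\<close> and \<open>\<alpha> q \<noteq> 0\<close>, the vectors
  \<open>e\<^sub>r - (\<alpha> r / \<alpha> q) e\<^sub>q\<close> (\<open>r \<noteq> q\<close>) span the orthogonal complement of \<open>\<alpha>\<close>.
\<close>

lemma wedge_surj:
  fixes a :: "('n::{finite,linorder}, 'k::{finite,linorder}) kvector"
  assumes card: "CARD('n) = Suc CARD('k)" and "a \<noteq> 0"
  obtains v where "wedge v = a"
proof -
  define \<alpha> where "\<alpha> i = hyper_coord i a" for i
  obtain q where q: "\<alpha> q \<noteq> 0"
    using hyper_coord_eqI [OF card, of a 0] \<open>a \<noteq> 0\<close> unfolding \<alpha>_def hyper_coord_0 by blast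
  define \<beta> :: "'k \<Rightarrow> 'n" where "\<beta> = enum_set (UNIV - {q})"
  have inj: "inj \<beta>" and im: "range \<beta> = UNIV - {q}"
    using bij_enum_set_hyper [OF card, of q] by (auto simp: \<beta>_def bij_betw_def)
  have ne: "\<beta> j \<noteq> q" for j using im by blast
  define v :: "'k \<Rightarrow> (real, 'n) vec" where "v j = axis (\<beta> j) 1 - (\<alpha> (\<beta> j) / \<alpha> q) *\<^sub>R axis q 1" for j
  define x where "x i = hyper_coord i (wedge v)" for i
  \<comment> \<open>The minor that omits row \<open>q\<close> is the identity, so the coordinate
    \<open>x q\<close> is a sign.\<close>
  have "(\<chi> r b. v b $ \<beta> r) = (mat 1 :: ((real, 'k) vec, 'k) vec)"
    using ne inj by (auto simp: v_def vec_eq_iff mat_def axis_def inj_eq)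
  then have "x q = (-1) ^ card {..<q}"
    using hyper_coord_wedge_minor [OF card, of q v] by (simp add: x_def \<beta>_def)
  then have xq: "x q \<noteq> 0" by simp
  \<comment> \<open>Orthogonality of \<open>x\<close> to \<open>v j\<close> determines
    \<open>x (\<beta> j)\<close> from \<open>x q\<close>, in the same ratio as for
    \<open>\<alpha>\<close>.\<close>
  have "x i = (x q / \<alpha> q) * \<alpha> i" for i
  proof (cases "i = q")
    case False
    then obtain j where i: "i = \<beta> j" using im by (auto simp: image_iff set_eq_iff)
    have "0 = (\<Sum>i'\<in>UNIV. v j $ i' * x i')"
      using wedge_orthogonal [OF card, of v j] by (simp add: x_def)
    also have "\<dots> = (\<Sum>i'\<in>UNIV. (if i' = i then x i else 0) - (if i' = q then \<alpha> i / \<alpha> q * x q else 0))"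
      by (rule sum.cong) (auto simp: v_def axis_def i)
    also have "\<dots> = x i - \<alpha> i / \<alpha> q * x q" by (simp add: sum_subtractf)
    finally show ?thesis by simp
  qed (use q in simp)
  then have x: "x i * (\<alpha> q / x q) = \<alpha> i" for i using q xq by (simp add: field_simps)
  \<comment> \<open>The wedge is linear in each vector, so scaling a single one, chosen arbitrarily,
    corrects the factor.\<close>
  define j0 :: 'k where "j0 = undefined"
  have "wedge (v(j0 := (\<alpha> q / x q) *\<^sub>R v j0)) = (\<alpha> q / x q) *\<^sub>R wedge v"
    using linear_cmul [OF linear_wedge [of v j0], of "\<alpha> q / x q" "v j0"] by simp
  also have "\<dots> = a"
    by (rule hyper_coord_eqI [OF card])
      (use x in \<open>simp add: linear_cmul [OF linear_hyper_coord] x_def \<alpha>_def mult.commute\<close>)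
  finally show ?thesis by (rule that)
qed

text \<open>A nonzero wedge has a nonzero minor, which already forces the coefficients
  \<open>t\<close> to vanish. This turns the vectors from \<open>wedge_surj\<close> into a
  parametrization of a hyperplane.\<close>

lemma inj_if_wedge_nonzero:
  fixes v :: "'k::{finite,linorder} \<Rightarrow> (real, 'n::{finite,linorder}) vec"
  assumes "wedge v \<noteq> 0"
  shows "inj (\<lambda>t :: (real, 'k) vec. \<Sum>j\<in>UNIV. t $ j *\<^sub>R v j)"
proof -
  have lin: "linear (\<lambda>t :: (real, 'k) vec. \<Sum>j\<in>UNIV. t $ j *\<^sub>R v j)"
    by (rule linearI) (simp_all add: scaleR_add_left sum.distrib scaleR_sum_right)
  obtain I where "kcoords (wedge v) $ I \<noteq> 0"
    using assms by (auto simp: zero_kvector.rep_eq vec_eq_iff simp flip: kcoords_inject)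
  then have "det ((\<chi> a b. v b $ enum_set I a) :: ((real, 'k) vec, 'k) vec) \<noteq> 0"
    by (auto simp: wedge.rep_eq split: if_splits)
  then have inj: "inj ((*v) ((\<chi> a b. v b $ enum_set I a) :: ((real, 'k) vec, 'k) vec))"
    by (simp add: det_nz_iff_inj_mult)
  show ?thesis
    unfolding linear_injective_0 [OF lin]
  proof (intro allI impI)
    fix t :: "(real, 'k) vec" assume "(\<Sum>j\<in>UNIV. t $ j *\<^sub>R v j) = 0"
    then have "(\<Sum>j\<in>UNIV. t $ j *\<^sub>R v j) $ r = 0" for r by simp
    then have "(\<chi> a b. v b $ enum_set I a) *v t = 0"
      by (simp add: vec_eq_iff matrix_vector_mult_def sum_component mult.commute)
    with inj show "t = 0" by (metis injD matrix_vector_mult_0_right)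
  qed
qed

section \<open>Smooth maps\<close>

lemma dir_deriv_eq:
  assumes "(f has_derivative f') (at p)"
  shows "dir_deriv v f p = f' v"
  using frechet_derivative_at [OF assms] by (simp add: dir_deriv_def)

lemma has_derivative_dir_deriv:
  assumes "f differentiable (at p)"
  shows "(f has_derivative (\<lambda>v. dir_deriv v f p)) (at p)"
  using assms by (simp add: dir_deriv_def frechet_derivative_works)

lemma Ck_on_SucD: "Ck_on (Suc m) S f \<Longrightarrow> Ck_on m S f"
proof (induction m arbitrary: f)
  case 0
  then show ?case
    by (auto intro!: continuous_at_imp_continuous_on differentiable_imp_continuous_within)
next
  case (Suc m)
  then show ?case by (metis Ck_on.simps(2))
qed

lemma smooth_on_imp_continuous_on: "smooth_on S f \<Longrightarrow> continuous_on S f"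
  unfolding smooth_on_def using Ck_on.simps(1) by blast

lemma smooth_on_imp_differentiable: "smooth_on S f \<Longrightarrow> p \<in> S \<Longrightarrow> f differentiable (at p)"
  unfolding smooth_on_def using Ck_on.simps(2) by blast

lemma smooth_on_dir_deriv: "smooth_on S f \<Longrightarrow> smooth_on S (dir_deriv v f)"
  unfolding smooth_on_def using Ck_on.simps(2) by blast

text \<open>\<open>frechet_derivative\<close> is a choice among the derivatives at \<open>p\<close>.
  Both functions have the same ones there, so the choices agree, even if there is none.\<close>

lemma dir_deriv_cong:
  assumes "open S" "p \<in> S" "\<And>x. x \<in> S \<Longrightarrow> f x = g x"
  shows "dir_deriv v f p = dir_deriv v g p"
proof -
  have "(f has_derivative f') (at p) \<longleftrightarrow> (g has_derivative f') (at p)" for f'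
    using has_derivative_transform_within_open [OF _ assms(1,2), of f f' UNIV g]
      has_derivative_transform_within_open [OF _ assms(1,2), of g f' UNIV f] assms(3) by auto
  then show ?thesis by (simp add: dir_deriv_def frechet_derivative_def)
qed

lemma Ck_on_cong:
  assumes "open S" "\<And>x. x \<in> S \<Longrightarrow> f x = g x" "Ck_on m S f"
  shows "Ck_on m S g"
  using assms(2,3)
proof (induction m arbitrary: f g)
  case 0
  then show ?case using continuous_on_cong [of S S f g] by simp
next
  case (Suc m)
  have "g differentiable (at p)" if "p \<in> S" for p
  proof -
    obtain f' where "(f has_derivative f') (at p)"
      using Suc.prems(2) \<open>p \<in> S\<close> by (auto simp: differentiable_def)
    then have "(g has_derivative f') (at p)"
      using has_derivative_transform_within_open [OF _ \<open>open S\<close> \<open>p \<in> S\<close>] Suc.prems(1) by blast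
    then show ?thesis by (auto simp: differentiable_def)
  qed
  moreover have "Ck_on m S (dir_deriv v g)" for v
    using Suc.prems dir_deriv_cong [OF \<open>open S\<close>, of _ f g v]
    by (blast intro: Suc.IH [of "dir_deriv v f" "dir_deriv v g"] dest: Ck_on.simps(2) [THEN iffD1])
  ultimately show ?case by simp
qed

text \<open>Lets inductions on the order work with a derivative given by a formula. The formula
  agrees with \<open>dir_deriv\<close> only on \<open>S\<close>, hence the use of
  \<open>Ck_on_cong\<close>.\<close>

lemma Ck_on_SucI:
  assumes "open S" "\<And>p. p \<in> S \<Longrightarrow> (f has_derivative (\<lambda>v. f' v p)) (at p)"
    and "\<And>v. Ck_on m S (f' v)"
  shows "Ck_on (Suc m) S f"
proof -
  have "Ck_on m S (dir_deriv v f)" for v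
    by (rule Ck_on_cong [OF \<open>open S\<close> _ assms(3)]) (simp add: dir_deriv_eq [OF assms(2)])
  then show ?thesis using assms(2) by (auto simp: differentiable_def)
qed

lemma Ck_on_const: "Ck_on m S (\<lambda>x. c)"
proof (induction m arbitrary: c)
  case (Suc m)
  have "dir_deriv v (\<lambda>x. c) = (\<lambda>x. 0)" for v :: 'a
    by (rule ext, rule dir_deriv_eq) (rule has_derivative_const)
  with Suc show ?case by simp
qed simp

lemma smooth_on_bounded_linear:
  assumes "bounded_linear f"
  shows "smooth_on S f"
proof -
  have "dir_deriv v f = (\<lambda>x. f v)" for v
    by (rule ext, rule dir_deriv_eq) (rule bounded_linear_imp_has_derivative [OF assms])
  then have "Ck_on m S f" for m
    by (cases m)
      (auto simp: Ck_on_const linear_continuous_on [OF assms] bounded_linear_imp_differentiable [OF assms])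
  then show ?thesis by (simp add: smooth_on_def)
qed

lemma smooth_on_const: "smooth_on S (\<lambda>x. c)"
  by (simp add: smooth_on_def Ck_on_const)

lemma Ck_on_add:
  assumes "open S" "Ck_on m S f" "Ck_on m S g"
  shows "Ck_on m S (\<lambda>x. f x + g x)"
  using assms(2,3)
proof (induction m arbitrary: f g)
  case (Suc m)
  show ?case
  proof (rule Ck_on_SucI [OF \<open>open S\<close>])
    show "Ck_on m S (\<lambda>p. dir_deriv v f p + dir_deriv v g p)" for v
      using Suc by simp
    show "((\<lambda>x. f x + g x) has_derivative (\<lambda>v. dir_deriv v f p + dir_deriv v g p)) (at p)"
      if "p \<in> S" for p
      using Suc.prems that by (auto intro!: has_derivative_add has_derivative_dir_deriv)
  qed
qed (auto intro: continuous_on_add)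

lemma smooth_on_add:
  "open S \<Longrightarrow> smooth_on S f \<Longrightarrow> smooth_on S g \<Longrightarrow> smooth_on S (\<lambda>x. f x + g x)"
  by (auto simp: smooth_on_def intro: Ck_on_add)

text \<open>The product rule leaves one factor undifferentiated, so the induction also needs the
  lower order of \<open>f\<close> and \<open>g\<close>, from \<open>Ck_on_SucD\<close>.\<close>

lemma (in bounded_bilinear) Ck_on_prod:
  assumes "open S" "Ck_on m S f" "Ck_on m S g"
  shows "Ck_on m S (\<lambda>x. prod (f x) (g x))"
  using assms(2,3)
proof (induction m arbitrary: f g)
  case (Suc m)
  show ?case
  proof (rule Ck_on_SucI [OF \<open>open S\<close>])
    show "Ck_on m S (\<lambda>p. prod (f p) (dir_deriv v g p) + prod (dir_deriv v f p) (g p))" for v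
      using Suc.prems Suc.prems [THEN Ck_on_SucD]
      by (intro Ck_on_add [OF \<open>open S\<close>] Suc.IH) auto
    show "((\<lambda>x. prod (f x) (g x)) has_derivative (\<lambda>v. prod (f p) (dir_deriv v g p) + prod (dir_deriv v f p) (g p))) (at p)"
      if "p \<in> S" for p
      using Suc.prems that by (auto intro!: FDERIV has_derivative_dir_deriv)
  qed
qed (auto intro: continuous_on)

lemma (in bounded_bilinear) smooth_on_prod:
  "open S \<Longrightarrow> smooth_on S f \<Longrightarrow> smooth_on S g \<Longrightarrow> smooth_on S (\<lambda>x. prod (f x) (g x))"
  by (auto simp: smooth_on_def intro: Ck_on_prod)

text \<open>The chain rule gives the product of \<open>h'\<close> at \<open>f\<close> with the
  derivative of \<open>f\<close>; the induction runs over all smooth \<open>h\<close>, since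
  \<open>h'\<close> takes the place of \<open>h\<close>.\<close>

lemma smooth_on_compose_real:
  fixes h :: "real \<Rightarrow> real"
  assumes "open S" "smooth_on UNIV h" "smooth_on S f"
  shows "smooth_on S (\<lambda>x. h (f x))"
proof -
  have "Ck_on m S (\<lambda>x. h (f x))" for m
    using assms(2)
  proof (induction m arbitrary: h)
    case 0
    then show ?case
      using smooth_on_imp_continuous_on [OF 0] smooth_on_imp_continuous_on [OF assms(3)]
      by (auto intro: continuous_on_compose2)
  next
    case (Suc m)
    show ?case
    proof (rule Ck_on_SucI [OF \<open>open S\<close>])
      show "Ck_on m S (\<lambda>p. dir_deriv 1 h (f p) * dir_deriv v f p)" for v
        using Suc.IH smooth_on_dir_deriv [OF Suc.prems] smooth_on_dir_deriv [OF assms(3)]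
        by (intro bounded_bilinear.Ck_on_prod [OF bounded_bilinear_mult \<open>open S\<close>]) (auto simp: smooth_on_def)
      show "((\<lambda>x. h (f x)) has_derivative (\<lambda>v. dir_deriv 1 h (f p) * dir_deriv v f p)) (at p)"
        if "p \<in> S" for p
      proof -
        have h: "(h has_derivative (\<lambda>v. dir_deriv v h (f p))) (at (f p))"
          using Suc.prems by (intro has_derivative_dir_deriv) (auto dest: smooth_on_imp_differentiable)
        have "dir_deriv v h (f p) = dir_deriv 1 h (f p) * v" for v
          using linear_cmul [OF has_derivative_linear [OF h], of v 1] by simp
        then have "(h has_derivative (\<lambda>v. dir_deriv 1 h (f p) * v)) (at (f p))"
          by (intro has_derivative_eq_rhs [OF h] ext)
        from has_derivative_compose [OF has_derivative_dir_deriv [of f p] this] show ?thesis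
          using assms(3) that by (auto dest: smooth_on_imp_differentiable)
      qed
    qed
  qed
  then show ?thesis by (simp add: smooth_on_def)
qed

section \<open>A smooth function that is flat at 0\<close>

text \<open>The span of these functions is closed under differentiation.\<close>

definition flat_exp :: "nat \<Rightarrow> real \<Rightarrow> real" where
  "flat_exp k x = (if x > 0 then (1 / x) ^ k * exp (- (1 / x)) else 0)"

lemma flat_exp_tendsto_0: "((\<lambda>x. flat_exp k x) \<longlongrightarrow> 0) (at 0)"
proof -
  have "((\<lambda>x. (1 / x) ^ k / exp (1 / x)) \<longlongrightarrow> 0) (at_right (0 :: real))"
    by (rule filterlim_compose [OF tendsto_power_div_exp_0 [of k]])
      (use filterlim_inverse_at_top_right in \<open>simp add: inverse_eq_divide\<close>)
  then have "((\<lambda>x. flat_exp k x) \<longlongrightarrow> 0) (at_right 0)"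
    by (rule Lim_transform_eventually)
      (auto simp: flat_exp_def exp_minus divide_inverse eventually_at_right_less
        intro!: eventually_at_rightI [of 0 1])
  moreover have "((\<lambda>x. flat_exp k x) \<longlongrightarrow> 0) (at_left 0)"
    by (rule Lim_transform_eventually [OF tendsto_const])
      (auto simp: flat_exp_def intro!: eventually_at_leftI [of "-1"])
  ultimately show ?thesis by (simp add: filterlim_at_split)
qed

lemma flat_exp_has_derivative:
  "(flat_exp k has_real_derivative (flat_exp (k + 2) x - k * flat_exp (k + 1) x)) (at x)"
proof (cases x "0 :: real" rule: linorder_cases)
  case less
  have "((\<lambda>x. 0) has_real_derivative (flat_exp (k + 2) x - k * flat_exp (k + 1) x)) (at x)"
    using less by (auto simp: flat_exp_def)
  then show ?thesis
    by (rule has_field_derivative_transform_within_open [of _ _ _ "{..<0}"])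
      (use less in \<open>auto simp: flat_exp_def\<close>)
next
  case equal
  \<comment> \<open>The difference quotient of \<open>flat_exp k\<close> at 0 is
    \<open>flat_exp (Suc k)\<close>.\<close>
  have "((\<lambda>h. flat_exp (Suc k) h) \<longlongrightarrow> 0) (at 0)" by (rule flat_exp_tendsto_0)
  then have "((\<lambda>h. (flat_exp k h - flat_exp k 0) / (h - 0)) \<longlongrightarrow> 0) (at 0)"
    by (rule Lim_transform_eventually)
      (auto simp: flat_exp_def eventually_at_filter)
  then show ?thesis using equal by (simp add: has_field_derivative_iff flat_exp_def)
next
  case greater
  define y where "y = 1 / x"
  have inv: "((\<lambda>x. 1 / x) has_real_derivative - (y ^ 2)) (at x)"
    using greater by (auto intro!: derivative_eq_intros simp: y_def power2_eq_square)
  have pow: "((\<lambda>x. (1 / x) ^ k) has_real_derivative real k * (- (y ^ 2) * y ^ (k - Suc 0))) (at x)"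
    using DERIV_power [OF inv, of k] by (simp add: y_def)
  have exp: "((\<lambda>x. exp (- (1 / x))) has_real_derivative exp (- y) * y ^ 2) (at x)"
    using DERIV_fun_exp [OF DERIV_minus [OF inv]] by (simp add: y_def)
  have "((\<lambda>x. (1 / x) ^ k * exp (- (1 / x))) has_real_derivative
      real k * (- (y ^ 2) * y ^ (k - Suc 0)) * exp (- y) + exp (- y) * y ^ 2 * y ^ k) (at x)"
    using DERIV_mult [OF pow exp] by (simp add: y_def)
  \<comment> \<open>If \<open>k = 0\<close>, the truncated exponent \<open>k - Suc 0\<close> comes
    with the factor 0.\<close>
  moreover have "real k * (- (y ^ 2) * y ^ (k - Suc 0)) * exp (- y) + exp (- y) * y ^ 2 * y ^ k =
      flat_exp (k + 2) x - k * flat_exp (k + 1) x"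
    using greater
    by (cases k) (simp_all add: flat_exp_def power2_eq_square algebra_simps flip: y_def)
  ultimately have "((\<lambda>x. (1 / x) ^ k * exp (- (1 / x))) has_real_derivative
      (flat_exp (k + 2) x - k * flat_exp (k + 1) x)) (at x)" by (simp only:)
  then show ?thesis
    by (rule has_field_derivative_transform_within_open [of _ _ _ "{0<..}"])
      (use greater in \<open>auto simp: flat_exp_def\<close>)
qed

lemma smooth_on_flat_exp: "smooth_on UNIV (flat_exp k)"
proof -
  have "Ck_on m UNIV (flat_exp k)" for m
  proof (induction m arbitrary: k)
    case 0
    have "isCont (flat_exp k) x" for x by (rule DERIV_isCont [OF flat_exp_has_derivative])
    then show ?case by (simp add: continuous_at_imp_continuous_on)
  next
    case (Suc m)
    show ?case
    proof (rule Ck_on_SucI)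
      show "(flat_exp k has_derivative
          (\<lambda>v. v * flat_exp (k + 2) p + (- v * k) * flat_exp (k + 1) p)) (at p)" for p
        by (rule has_derivative_eq_rhs
            [OF flat_exp_has_derivative [unfolded has_field_derivative_def]])
          (simp add: fun_eq_iff algebra_simps)
      show "Ck_on m UNIV (\<lambda>p. v * flat_exp (k + 2) p + (- v * k) * flat_exp (k + 1) p)" for v
        by (intro Ck_on_add bounded_bilinear.Ck_on_prod [OF bounded_bilinear_mult] Ck_on_const Suc) simp_all
    qed simp
  qed
  then show ?thesis by (simp add: smooth_on_def)
qed

section \<open>Calculus for integrands of degree \<open>n - 1\<close>\<close>

lemma bounded_linear_hyper_coord: "bounded_linear (hyper_coord i)"
proof (rule bounded_linear_intro)
  show "norm (hyper_coord i a) \<le> norm a * 1" for a :: "('a, 'b) kvector"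
    using component_le_norm_cart [of "kcoords a" "UNIV - {i}"]
    by (simp add: hyper_coord_def abs_mult norm_kvector.rep_eq power_abs)
qed (simp_all add: linear_add [OF linear_hyper_coord] linear_cmul [OF linear_hyper_coord])

text \<open>\<open>kvector\<close> carries only the structure of a normed space here; analysis of
  maps into it is reduced to finitely many real coordinates by
  \<open>hyper_expansion\<close>.\<close>

lemma continuous_on_kvectorI:
  fixes f :: "'z::topological_space \<Rightarrow> ('n::{finite,linorder}, 'k::{finite,linorder}) kvector"
  assumes card: "CARD('n) = Suc CARD('k)"
    and "\<And>i. continuous_on S (\<lambda>z. hyper_coord i (f z))"
  shows "continuous_on S f"
proof -
  have "continuous_on S (\<lambda>z. \<Sum>i\<in>UNIV. hyper_coord i (f z) *\<^sub>R (hyper_basis i :: ('n, 'k) kvector))"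
    using assms(2) by (intro continuous_intros)
  then show ?thesis by (simp flip: hyper_expansion [OF card])
qed

lemma has_vector_derivative_kvectorI:
  fixes f :: "real \<Rightarrow> ('n::{finite,linorder}, 'k::{finite,linorder}) kvector"
  assumes card: "CARD('n) = Suc CARD('k)"
    and "\<And>i. ((\<lambda>s. hyper_coord i (f s)) has_real_derivative hyper_coord i f') (at s)"
  shows "(f has_vector_derivative f') (at s)"
proof -
  have "((\<lambda>s. \<Sum>i\<in>UNIV. hyper_coord i (f s) *\<^sub>R (hyper_basis i :: ('n, 'k) kvector))
      has_vector_derivative (\<Sum>i\<in>UNIV. hyper_coord i f' *\<^sub>R hyper_basis i)) (at s)"
  proof (rule has_vector_derivative_sum)
    show "((\<lambda>s. hyper_coord i (f s) *\<^sub>R (hyper_basis i :: ('n, 'k) kvector))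
        has_vector_derivative hyper_coord i f' *\<^sub>R hyper_basis i) (at s)" for i
      using has_vector_derivative_scaleR [OF assms(2) has_vector_derivative_const] by simp
  qed
  then show ?thesis by (simp flip: hyper_expansion [OF card])
qed

lemma continuous_on_wedge:
  fixes g :: "'k::{finite,linorder} \<Rightarrow> 'z::topological_space \<Rightarrow> (real, 'n::{finite,linorder}) vec"
  assumes card: "CARD('n) = Suc CARD('k)" and "\<And>j. continuous_on S (g j)"
  shows "continuous_on S (\<lambda>z. wedge (\<lambda>j. g j z))"
  using assms(2)
  by (intro continuous_on_kvectorI [OF card])
    (auto simp: hyper_coord_wedge_minor [OF card] det_def intro!: continuous_intros)

text \<open>Product rule in each Leibniz term: for the permutation \<open>p\<close>, differentiating
  the factor of row \<open>a\<close> amounts to replacing column \<open>p a\<close>; reindexing by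
  \<open>p\<close> gives the sum over columns.\<close>

lemma det_columns_has_derivative:
  fixes v :: "'k::finite \<Rightarrow> real \<Rightarrow> (real, 'n::finite) vec" and f :: "'k \<Rightarrow> 'n"
  assumes "\<And>j. (v j has_vector_derivative v' j) (at s)"
  shows "((\<lambda>s. det ((\<chi> a b. v b s $ f a) :: ((real, 'k) vec, 'k) vec)) has_real_derivative
    (\<Sum>j\<in>UNIV. det ((\<chi> a b. ((\<lambda>l. v l s)(j := v' j)) b $ f a) :: ((real, 'k) vec, 'k) vec))) (at s)"
proof -
  have comp: "((\<lambda>s. v b s $ i) has_real_derivative v' b $ i) (at s)" for b i
    using bounded_linear.has_vector_derivative [OF bounded_linear_vec_nth assms]
    by (simp add: has_real_derivative_iff_has_vector_derivative)
  have "((\<lambda>s. \<Sum>p | p permutes (UNIV :: 'k set). of_int (sign p) * (\<Prod>a\<in>UNIV. v (p a) s $ f a))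
      has_real_derivative (\<Sum>p | p permutes (UNIV :: 'k set). of_int (sign p) *
        (\<Sum>a\<in>UNIV. v' (p a) $ f a * (\<Prod>b\<in>UNIV - {a}. v (p b) s $ f b)))) (at s)"
    by (intro DERIV_sum DERIV_cmult has_field_derivative_prod comp)
  moreover have "(\<Sum>a\<in>UNIV. v' (p a) $ f a * (\<Prod>b\<in>UNIV - {a}. v (p b) s $ f b)) =
      (\<Sum>j\<in>UNIV. \<Prod>a\<in>UNIV. ((\<lambda>l. v l s)(j := v' j)) (p a) $ f a)"
    if "p permutes UNIV" for p :: "'k \<Rightarrow> 'k"
  proof -
    have inj: "inj p" using that by (rule permutes_inj)
    have "v' (p a) $ f a * (\<Prod>b\<in>UNIV - {a}. v (p b) s $ f b) =
        (\<Prod>b\<in>UNIV. ((\<lambda>l. v l s)(p a := v' (p a))) (p b) $ f b)" for a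
      using inj by (subst prod.remove [of UNIV a]) (auto simp: inj_eq intro!: prod.cong)
    then show ?thesis
      using sum.permute [OF that, of "\<lambda>j. \<Prod>a\<in>UNIV. ((\<lambda>l. v l s)(j := v' j)) (p a) $ f a"]
      by (simp add: o_def)
  qed
  ultimately show ?thesis
    unfolding det_def by (subst sum.swap) (simp add: sum_distrib_left)
qed

lemma wedge_has_vector_derivative:
  fixes v :: "'k::{finite,linorder} \<Rightarrow> real \<Rightarrow> (real, 'n::{finite,linorder}) vec"
  assumes card: "CARD('n) = Suc CARD('k)"
    and v: "\<And>j. (v j has_vector_derivative v' j) (at s)"
  shows "((\<lambda>s. wedge (\<lambda>j. v j s)) has_vector_derivative
    (\<Sum>j\<in>UNIV. wedge ((\<lambda>l. v l s)(j := v' j)))) (at s)"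
proof (rule has_vector_derivative_kvectorI [OF card])
  fix i
  show "((\<lambda>s. hyper_coord i (wedge (\<lambda>j. v j s))) has_real_derivative
      hyper_coord i (\<Sum>j\<in>UNIV. wedge ((\<lambda>l. v l s)(j := v' j)))) (at s)"
    unfolding hyper_coord_wedge_minor [OF card] linear_sum [OF linear_hyper_coord]
      sum_distrib_left [symmetric]
    by (intro DERIV_cmult det_columns_has_derivative v)
qed

lemma linear_dir_deriv:
  assumes "f differentiable (at p)"
  shows "linear (\<lambda>v. dir_deriv v f p)"
  using has_derivative_linear [OF has_derivative_dir_deriv [OF assms]] .

text \<open>Linearity in the inner direction: the first derivatives must be additive on a whole
  neighbourhood of \<open>p\<close> before they are differentiated again.\<close>

lemma linear_dir_deriv_dir_deriv:
  assumes "open S" "smooth_on S f" "p \<in> S"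
  shows "linear (\<lambda>v. dir_deriv u (dir_deriv v f) p)"
proof (rule linearI)
  have diff: "f differentiable (at x)" if "x \<in> S" for x
    using assms(2) that by (rule smooth_on_imp_differentiable)
  have der: "(dir_deriv v f has_derivative (\<lambda>u. dir_deriv u (dir_deriv v f) p)) (at p)" for v
    by (intro has_derivative_dir_deriv
        smooth_on_imp_differentiable [OF smooth_on_dir_deriv [OF assms(2)] assms(3)])
  fix v w :: 'a and r :: real
  have "dir_deriv u (dir_deriv (v + w) f) p = dir_deriv u (\<lambda>x. dir_deriv v f x + dir_deriv w f x) p"
    by (rule dir_deriv_cong [OF assms(1,3)]) (rule linear_add [OF linear_dir_deriv [OF diff]])
  also have "\<dots> = dir_deriv u (dir_deriv v f) p + dir_deriv u (dir_deriv w f) p"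
    by (rule dir_deriv_eq) (rule has_derivative_add [OF der der])
  finally show "dir_deriv u (dir_deriv (v + w) f) p =
      dir_deriv u (dir_deriv v f) p + dir_deriv u (dir_deriv w f) p" .
  have "dir_deriv u (dir_deriv (r *\<^sub>R v) f) p = dir_deriv u (\<lambda>x. r *\<^sub>R dir_deriv v f x) p"
    by (rule dir_deriv_cong [OF assms(1,3)]) (rule linear_cmul [OF linear_dir_deriv [OF diff]])
  also have "\<dots> = r *\<^sub>R dir_deriv u (dir_deriv v f) p"
    by (rule dir_deriv_eq) (rule has_derivative_scaleR_right [OF der])
  finally show "dir_deriv u (dir_deriv (r *\<^sub>R v) f) p = r *\<^sub>R dir_deriv u (dir_deriv v f) p" .
qed

text \<open>By translation invariance the integral of \<open>w (t + h *\<^sub>R e)\<close> does not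
  depend on \<open>h\<close>; its derivative at \<open>h = 0\<close> is the integral of
  \<open>w'\<close>.\<close>

lemma integral_directional_derivative_eq_0:
  fixes w :: "'a::euclidean_space \<Rightarrow> real"
  assumes deriv: "\<And>t. ((\<lambda>h. w (t + h *\<^sub>R e)) has_real_derivative w' t) (at 0)"
    and cont: "continuous_on UNIV w" "continuous_on UNIV w'"
    and zero: "\<And>t. t \<notin> cbox a b \<Longrightarrow> w t = 0" "\<And>t. t \<notin> cbox a b \<Longrightarrow> w' t = 0"
  shows "integral (cbox a b) w' = 0"
proof -
  let ?U = "{-1<..<1} :: real set"
  \<comment> \<open>One box that contains all the shifted copies of \<open>cbox a b\<close>, so that
    the domain of integration is the same for every \<open>h\<close> in \<open>?U\<close>.\<close>
  have "compact ((\<lambda>(h, t). t - h *\<^sub>R e) ` ({-1..1} \<times> cbox a b))"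
    by (intro compact_continuous_image compact_Times compact_cbox compact_Icc)
      (auto simp: case_prod_beta intro!: continuous_intros)
  then obtain c where c: "(\<lambda>(h, t). t - h *\<^sub>R e) ` ({-1..1} \<times> cbox a b) \<subseteq> cbox (- c) c"
    using bounded_subset_cbox_symmetric compact_imp_bounded by blast
  then have sub: "t - h *\<^sub>R e \<in> cbox (- c) c" if "\<bar>h\<bar> \<le> 1" "t \<in> cbox a b" for h t
    using that by (force simp: abs_le_iff)
  have const: "integral (cbox (- c) c) (\<lambda>t. f (t + h *\<^sub>R e)) = integral (cbox a b) f"
    if "h \<in> ?U" "continuous_on UNIV f" "\<And>t. t \<notin> cbox a b \<Longrightarrow> f t = 0" for h and f :: "'a \<Rightarrow> real"
  proof -
    have "(f has_integral integral (cbox a b) f) (cbox a b)"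
      using that by (intro integrable_integral integrable_continuous) (auto intro: continuous_on_subset)
    then have shifted: "((\<lambda>t. f (t + h *\<^sub>R e)) has_integral integral (cbox a b) f)
        (cbox (a - h *\<^sub>R e) (b - h *\<^sub>R e))"
      by (rule has_integral_shift_cbox)
    have in_iff: "t \<in> cbox (a - h *\<^sub>R e) (b - h *\<^sub>R e) \<longleftrightarrow> t + h *\<^sub>R e \<in> cbox a b" for t
      by (simp add: mem_box algebra_simps)
    from shifted have "((\<lambda>t. f (t + h *\<^sub>R e)) has_integral integral (cbox a b) f) (cbox (- c) c)"
    proof (rule has_integral_on_superset)
      show "f (t + h *\<^sub>R e) = 0" if "t \<notin> cbox (a - h *\<^sub>R e) (b - h *\<^sub>R e)" for t
        using that in_iff \<open>\<And>t. t \<notin> cbox a b \<Longrightarrow> f t = 0\<close> by blast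
      show "cbox (a - h *\<^sub>R e) (b - h *\<^sub>R e) \<subseteq> cbox (- c) c"
      proof
        fix t assume "t \<in> cbox (a - h *\<^sub>R e) (b - h *\<^sub>R e)"
        then show "t \<in> cbox (- c) c" using sub [of h "t + h *\<^sub>R e"] that(1) in_iff by auto
      qed
    qed
    then show ?thesis by (rule integral_unique)
  qed
  have zero_mem: "0 \<in> ?U" by simp
  have eq: "integral (cbox (- c) c) (\<lambda>t. w' (t + 0 *\<^sub>R e)) = integral (cbox a b) w'"
    by (rule const [OF zero_mem cont(2) zero(2)])
  have "((\<lambda>h. integral (cbox (- c) c) (\<lambda>t. w (t + h *\<^sub>R e))) has_real_derivative
      integral (cbox (- c) c) (\<lambda>t. w' (t + 0 *\<^sub>R e))) (at 0 within ?U)"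
  proof (rule leibniz_rule_field_derivative)
    show "((\<lambda>h. w (t + h *\<^sub>R e)) has_real_derivative w' (t + h *\<^sub>R e)) (at h within ?U)" for h t
    proof -
      have "((\<lambda>k. w ((t + h *\<^sub>R e) + (k - h) *\<^sub>R e)) has_real_derivative w' (t + h *\<^sub>R e)) (at h)"
        using deriv [of "t + h *\<^sub>R e"] DERIV_shift [of "\<lambda>k. w ((t + h *\<^sub>R e) + k *\<^sub>R e)" "w' (t + h *\<^sub>R e)" h "- h"]
        by simp
      moreover have "(t + h *\<^sub>R e) + (k - h) *\<^sub>R e = t + k *\<^sub>R e" for k
        by (simp add: scaleR_left_diff_distrib)
      ultimately show ?thesis by (simp only: has_field_derivative_at_within)
    qed
    show "(\<lambda>t. w (t + h *\<^sub>R e)) integrable_on cbox (- c) c" for h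
      by (intro integrable_continuous continuous_on_compose2 [OF cont(1)] continuous_intros) auto
    show "continuous_on (?U \<times> cbox (- c) c) (\<lambda>(h, t). w' (t + h *\<^sub>R e))"
      unfolding case_prod_beta
      by (intro continuous_on_compose2 [OF cont(2)] continuous_intros) auto
  qed auto
  then have "((\<lambda>h. integral (cbox (- c) c) (\<lambda>t. w (t + h *\<^sub>R e))) has_real_derivative
      integral (cbox a b) w') (at 0)"
    unfolding at_within_open [OF zero_mem open_greaterThanLessThan] eq .
  moreover have "((\<lambda>h. integral (cbox (- c) c) (\<lambda>t. w (t + h *\<^sub>R e))) has_real_derivative 0) (at 0)"
    by (rule has_field_derivative_transform_within_open
          [OF DERIV_const open_greaterThanLessThan zero_mem])
      (rule const [OF _ cont(1) zero(1), symmetric])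
  ultimately show ?thesis by (rule DERIV_unique)
qed

text \<open>For the set \<open>K\<close> of a variation, which may be any compact set; the proof
  passes through Lebesgue integrability.\<close>

lemma integrable_on_compact:
  fixes f :: "'a::euclidean_space \<Rightarrow> real"
  assumes "compact K" "continuous_on K f"
  shows "f integrable_on K"
  using borel_integrable_compact [OF assms]
  by (intro set_borel_integral_eq_integral) (simp add: set_integrable_def)

section \<open>Homogeneity and the Euler-Lagrange expression\<close>

lemma open_nonzero: "open (- (UNIV \<times> {0}) :: ('a::real_normed_vector \<times> 'b::real_normed_vector) set)"
  by (intro open_Compl closed_Times) simp_all

lemma differential_integrand_differentiable:
  assumes "differential_integrand \<Phi>" "a \<noteq> 0"
  shows "\<Phi> differentiable (at (x, a))"
  using assms by (auto simp: differential_integrand_def intro: smooth_on_imp_differentiable)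

lemma differential_integrand_dir_deriv_smooth:
  assumes "differential_integrand \<Phi>"
  shows "smooth_on (- (UNIV \<times> {0})) (dir_deriv v \<Phi>)"
  using assms by (auto simp: differential_integrand_def intro: smooth_on_dir_deriv)

lemma dir_deriv_Pair_left:
  assumes "f differentiable (at (x, a))"
  shows "dir_deriv u (\<lambda>y. f (y, a)) x = dir_deriv (u, 0) f (x, a)"
proof -
  have "((\<lambda>y. (y, a)) has_derivative (\<lambda>u. (u, 0))) (at x)"
    by (auto intro!: derivative_eq_intros)
  from has_derivative_compose [OF this has_derivative_dir_deriv [OF assms]]
  show ?thesis by (rule dir_deriv_eq)
qed

text \<open>Compares two derivatives of \<open>\<Phi> (x, t *\<^sub>R a)\<close> at
  \<open>t = 1\<close>: by the chain rule and by homogeneity.\<close>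

lemma euler_homogeneous:
  assumes \<Phi>: "differential_integrand \<Phi>" and a: "a \<noteq> 0"
  shows "dir_deriv (0, a) \<Phi> (x, a) = \<Phi> (x, a)"
proof -
  have "((\<lambda>t. (x, t *\<^sub>R a)) has_derivative (\<lambda>h. (0, h *\<^sub>R a))) (at 1)"
    by (auto intro!: derivative_eq_intros)
  moreover have "(\<Phi> has_derivative (\<lambda>v. dir_deriv v \<Phi> (x, a))) (at (x, 1 *\<^sub>R a))"
    using has_derivative_dir_deriv [OF differential_integrand_differentiable [OF \<Phi> a]] by simp
  ultimately have "((\<lambda>t. \<Phi> (x, t *\<^sub>R a)) has_derivative (\<lambda>h. dir_deriv (0, h *\<^sub>R a) \<Phi> (x, a))) (at 1)"
    by (rule has_derivative_compose)
  moreover have "((\<lambda>t. \<Phi> (x, t *\<^sub>R a)) has_derivative (\<lambda>h. h * \<Phi> (x, a))) (at 1)"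
    by (rule has_derivative_transform_within_open
        [of "\<lambda>t. t * \<Phi> (x, a)" _ _ _ "{0<..}"])
      (use \<Phi> in \<open>auto simp: differential_integrand_def parametric_integrand_def
          intro!: derivative_eq_intros\<close>)
  ultimately have "dir_deriv (0, 1 *\<^sub>R a) \<Phi> (x, a) = 1 * \<Phi> (x, a)"
    by (metis has_derivative_unique)
  then show ?thesis by simp
qed

text \<open>\<open>euler_homogeneous\<close> holds for every \<open>x\<close> with the same
  \<open>a\<close>, so it may be differentiated in \<open>x\<close>.\<close>

lemma dir_deriv_euler_homogeneous:
  assumes \<Phi>: "differential_integrand \<Phi>" and a: "a \<noteq> 0"
  shows "dir_deriv (u, 0) \<Phi> (x, a) = dir_deriv (u, 0) (dir_deriv (0, a) \<Phi>) (x, a)"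
proof -
  have "dir_deriv (0, a) \<Phi> differentiable (at (x, a))"
    by (rule smooth_on_imp_differentiable [OF differential_integrand_dir_deriv_smooth [OF \<Phi>]])
      (use a in simp)
  then show ?thesis
    using dir_deriv_Pair_left [OF differential_integrand_differentiable [OF \<Phi> a], of u x]
    by (simp add: dir_deriv_Pair_left euler_homogeneous [OF \<Phi> a] flip: dir_deriv_Pair_left)
qed

definition mixed_trace ::
  "((real, 'n::{finite,linorder}) vec \<times> ('n, 'k::{finite,linorder}) kvector \<Rightarrow> real) \<Rightarrow>
    (real, 'n) vec \<times> ('n, 'k) kvector \<Rightarrow> real" where
  "mixed_trace \<Phi> z = (\<Sum>i\<in>UNIV. dir_deriv (axis i 1, 0) (dir_deriv (0, hyper_basis i) \<Phi>) z)"

lemma euler_lagrange_hyperplane: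
  fixes \<Phi> :: "(real, 'n::{finite,linorder}) vec \<times> ('n, 'k::{finite,linorder}) kvector \<Rightarrow> real"
  assumes card: "CARD('n) = Suc CARD('k)" and \<Phi>: "differential_integrand \<Phi>" and a: "a \<noteq> 0"
    and v: "a = wedge v"
  shows "dir_deriv (u, 0) \<Phi> (x, a) -
      (\<Sum>j\<in>UNIV. dir_deriv (v j, 0) (dir_deriv (0, wedge (v(j := u))) \<Phi>) (x, a)) =
    (\<Sum>i\<in>UNIV. u $ i * hyper_coord i a) * mixed_trace \<Phi> (x, a)"
proof -
  define B where "B u b = dir_deriv (u, 0) (dir_deriv (0, b) \<Phi>) (x, a)"
    for u :: "(real, 'n) vec" and b :: "('n, 'k) kvector"
  have in_S: "(x, a) \<in> - (UNIV \<times> {0})" using a by simp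
  have "linear (\<lambda>u. dir_deriv (u, 0) (dir_deriv (0, b) \<Phi>) (x, a))" for b
    using linear_compose [OF _ linear_dir_deriv [OF smooth_on_imp_differentiable
          [OF differential_integrand_dir_deriv_smooth [OF \<Phi>] in_S]], of "\<lambda>u. (u, 0)"]
    by (simp add: linear_iff o_def)
  then have lin1: "linear (\<lambda>u. B u b)" for b by (simp add: B_def)
  have "linear (\<lambda>b. dir_deriv (u, 0) (dir_deriv (0, b) \<Phi>) (x, a))" for u
    using linear_compose [OF _ linear_dir_deriv_dir_deriv [OF open_nonzero _ in_S], of "\<lambda>b. (0, b)" \<Phi>] \<Phi>
    by (simp add: linear_iff o_def differential_integrand_def)
  then have lin2: "linear (\<lambda>b. B u b)" for u by (simp add: B_def)
  \<comment> \<open>\<open>B\<close> is bilinear, so only its values on basis vectors matter; of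
    these, \<open>wedge_cramer\<close> keeps the diagonal ones.\<close>
  have B: "B u b = (\<Sum>p\<in>UNIV. \<Sum>q\<in>UNIV. (u $ p * hyper_coord q b) * B (axis p 1) (hyper_basis q))" for u b
  proof -
    have right: "B w b = (\<Sum>q\<in>UNIV. hyper_coord q b * B w (hyper_basis q))" for w
      by (subst hyper_expansion [OF card, of b])
        (simp only: linear_sum [OF lin2] linear_cmul [OF lin2] real_scaleR_def)
    have "B u b = B (\<Sum>p\<in>UNIV. u $ p *\<^sub>R axis p 1) b"
      by (simp only: basis_expansion flip: scalar_mult_eq_scaleR)
    also have "\<dots> = (\<Sum>p\<in>UNIV. u $ p * B (axis p 1) b)"
      by (simp only: linear_sum [OF lin1] linear_cmul [OF lin1] real_scaleR_def)
    finally show ?thesis unfolding right by (simp add: sum_distrib_left mult.assoc)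
  qed
  have "B u a - (\<Sum>j\<in>UNIV. B (v j) (wedge (v(j := u)))) =
      (\<Sum>p\<in>UNIV. \<Sum>q\<in>UNIV. (u $ p * hyper_coord q a) * B (axis p 1) (hyper_basis q)) -
      (\<Sum>p\<in>UNIV. \<Sum>q\<in>UNIV. \<Sum>j\<in>UNIV. (v j $ p * hyper_coord q (wedge (v(j := u)))) * B (axis p 1) (hyper_basis q))"
    unfolding B [of u a] B [of "v _"]
    by (subst sum.swap, subst (2) sum.swap) simp
  also have "\<dots> = (\<Sum>p\<in>UNIV. \<Sum>q\<in>UNIV. (u $ p * hyper_coord q (wedge v) -
      (\<Sum>j\<in>UNIV. v j $ p * hyper_coord q (wedge (v(j := u))))) * B (axis p 1) (hyper_basis q))"
    by (simp only: sum_subtractf left_diff_distrib sum_distrib_right v)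
  also have "\<dots> = (\<Sum>p\<in>UNIV. (\<Sum>i\<in>UNIV. u $ i * hyper_coord i a) * B (axis p 1) (hyper_basis p))"
    unfolding wedge_cramer [OF card] v
    by (simp add: if_distrib [of "\<lambda>x. x * _"] cong: if_cong)
  finally show ?thesis
    by (simp add: dir_deriv_euler_homogeneous [OF \<Phi> a] B_def mixed_trace_def sum_distrib_left)
qed

section \<open>The first variation of a hyperplane\<close>

lemma has_vector_derivative_dir_deriv:
  assumes \<gamma>: "(\<gamma> has_vector_derivative \<gamma>') (at s)" and G: "G differentiable (at (\<gamma> s))"
  shows "((\<lambda>s. G (\<gamma> s)) has_vector_derivative dir_deriv \<gamma>' G (\<gamma> s)) (at s)"
proof -
  have "((\<lambda>s. G (\<gamma> s)) has_derivative (\<lambda>h. dir_deriv (h *\<^sub>R \<gamma>') G (\<gamma> s))) (at s)"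
    using has_derivative_compose [OF \<gamma> [unfolded has_vector_derivative_def]
        has_derivative_dir_deriv [OF G]] .
  then show ?thesis
    by (simp add: has_vector_derivative_def linear_cmul [OF linear_dir_deriv [OF G]])
qed

lemma has_vector_derivative_Pair:
  assumes "(f has_vector_derivative f') (at s)" "(g has_vector_derivative g') (at s)"
  shows "((\<lambda>s. (f s, g s)) has_vector_derivative (f', g')) (at s)"
  using has_derivative_Pair [OF assms [unfolded has_vector_derivative_def]]
  by (simp add: has_vector_derivative_def)

lemma linear_expansion_real:
  fixes f :: "(real, 'n::finite) vec \<Rightarrow> real"
  assumes "linear f"
  shows "f u = (\<Sum>m\<in>UNIV. u $ m * f (axis m 1))"
proof -
  have "f u = f (\<Sum>m\<in>UNIV. u $ m *\<^sub>R axis m 1)"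
    by (simp only: basis_expansion flip: scalar_mult_eq_scaleR)
  then show ?thesis
    by (simp only: linear_sum [OF assms] linear_cmul [OF assms] real_scaleR_def)
qed

text \<open>The direction varies with \<open>z\<close>. Expanding it in the bases leaves finitely
  many derivatives in fixed directions, which are continuous by smoothness.\<close>

lemma continuous_on_dir_deriv_integrand:
  fixes \<Phi> :: "(real, 'n::{finite,linorder}) vec \<times> ('n, 'k::{finite,linorder}) kvector \<Rightarrow> real"
    and u :: "'z::topological_space \<Rightarrow> (real, 'n) vec"
  assumes card: "CARD('n) = Suc CARD('k)" and \<Phi>: "differential_integrand \<Phi>"
    and cont: "continuous_on T u" "continuous_on T b" "continuous_on T x" "continuous_on T a"
    and nz: "\<And>z. z \<in> T \<Longrightarrow> a z \<noteq> 0"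
  shows "continuous_on T (\<lambda>z. dir_deriv (u z, b z) \<Phi> (x z, a z))"
proof -
  have eq: "dir_deriv (u z, b z) \<Phi> (x z, a z) =
      (\<Sum>i\<in>UNIV. u z $ i * dir_deriv (axis i 1, 0) \<Phi> (x z, a z)) +
      (\<Sum>i\<in>UNIV. hyper_coord i (b z) * dir_deriv (0, hyper_basis i) \<Phi> (x z, a z))"
    if "z \<in> T" for z
  proof -
    have lin: "linear (\<lambda>v. dir_deriv v \<Phi> (x z, a z))"
      by (intro linear_dir_deriv differential_integrand_differentiable [OF \<Phi>] nz that)
    have lin1: "linear (\<lambda>u. dir_deriv (u, 0) \<Phi> (x z, a z))"
      using linear_compose [OF _ lin, of "\<lambda>u. (u, 0)"] by (simp add: linear_iff o_def)
    have lin2: "linear (\<lambda>b. dir_deriv (0, b) \<Phi> (x z, a z))"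
      using linear_compose [OF _ lin, of "\<lambda>b. (0, b)"] by (simp add: linear_iff o_def)
    have "dir_deriv (u z, b z) \<Phi> (x z, a z) =
        dir_deriv (u z, 0) \<Phi> (x z, a z) + dir_deriv (0, b z) \<Phi> (x z, a z)"
      using linear_add [OF lin, of "(u z, 0)" "(0, b z)"] by simp
    also have "dir_deriv (u z, 0) \<Phi> (x z, a z) =
        (\<Sum>i\<in>UNIV. u z $ i * dir_deriv (axis i 1, 0) \<Phi> (x z, a z))"
      by (rule linear_expansion_real [OF lin1])
    also have "dir_deriv (0, b z) \<Phi> (x z, a z) =
        (\<Sum>i\<in>UNIV. hyper_coord i (b z) * dir_deriv (0, hyper_basis i) \<Phi> (x z, a z))"
      by (subst hyper_expansion [OF card, of "b z"])
        (simp only: linear_sum [OF lin2] linear_cmul [OF lin2] real_scaleR_def)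
    finally show ?thesis .
  qed
  have "continuous_on T (\<lambda>z. dir_deriv v \<Phi> (x z, a z))" for v
    using nz
    by (intro continuous_on_compose2 [OF smooth_on_imp_continuous_on
          [OF differential_integrand_dir_deriv_smooth [OF \<Phi>]]] continuous_intros cont) auto
  moreover have "continuous_on T (\<lambda>z. hyper_coord i (b z))" for i
    by (rule bounded_linear.continuous_on [OF bounded_linear_hyper_coord cont(2)])
  ultimately have "continuous_on T (\<lambda>z.
      (\<Sum>i\<in>UNIV. u z $ i * dir_deriv (axis i 1, 0) \<Phi> (x z, a z)) +
      (\<Sum>i\<in>UNIV. hyper_coord i (b z) * dir_deriv (0, hyper_basis i) \<Phi> (x z, a z)))"
    by (intro continuous_intros cont)
  then show ?thesis by (rule continuous_on_eq) (rule eq [symmetric])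
qed

section \<open>A fixed variation of a fixed hyperplane\<close>

locale hyperplane_variation =
  fixes \<Phi> :: "(real, 'n::{finite,linorder}) vec \<times> ('n, 'k::{finite,linorder}) kvector \<Rightarrow> real"
    and p :: "(real, 'n) vec" and L :: "(real, 'k) vec \<Rightarrow> (real, 'n) vec"
    and \<epsilon> :: real and K :: "(real, 'k) vec set" and F :: "real \<times> (real, 'k) vec \<Rightarrow> (real, 'n) vec"
  assumes card: "CARD('n) = Suc CARD('k)" and \<Phi>: "differential_integrand \<Phi>"
    and L: "linear L" "inj L"
    and var: "smooth_variation (\<lambda>t. p + L t) \<epsilon> K F"
begin

definition v :: "'k \<Rightarrow> (real, 'n) vec" where "v j = L (axis j 1)"
definition a0 :: "('n, 'k) kvector" where "a0 = wedge v"
definition Ft :: "'k \<Rightarrow> real \<times> (real, 'k) vec \<Rightarrow> (real, 'n) vec" where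
  "Ft j = dir_deriv (0, axis j 1) F"
definition Fs :: "real \<times> (real, 'k) vec \<Rightarrow> (real, 'n) vec" where "Fs = dir_deriv (1, 0) F"
text \<open>The \<open>t\<close>-derivative is taken first: in this order it is the
  \<open>s\<close>-derivative of \<open>Ft j\<close>, the only mixed derivative of \<open>F\<close>
  that occurs.\<close>

definition Fts :: "'k \<Rightarrow> real \<times> (real, 'k) vec \<Rightarrow> (real, 'n) vec" where
  "Fts j = dir_deriv (1, 0) (Ft j)"
definition W :: "real \<times> (real, 'k) vec \<Rightarrow> ('n, 'k) kvector" where "W z = wedge (\<lambda>j. Ft j z)"
definition \<phi> :: "real \<times> (real, 'k) vec \<Rightarrow> real" where "\<phi> z = \<Phi> (F z, W z)"
text \<open>The \<open>s\<close>-derivative of \<open>\<phi>\<close> wherever \<open>W z\<close> is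
  nonzero; elsewhere \<open>\<Phi>\<close> may fail to be differentiable.\<close>

definition \<phi>s :: "real \<times> (real, 'k) vec \<Rightarrow> real" where
  "\<phi>s z = dir_deriv (Fs z, \<Sum>j\<in>UNIV. wedge ((\<lambda>l. Ft l z)(j := Fts j z))) \<Phi> (F z, W z)"

abbreviation "I \<equiv> {-\<epsilon><..<\<epsilon>}"

lemma a0_nonzero: "a0 \<noteq> 0"
  using wedge_nonzero [OF card L] by (simp add: a0_def v_def [abs_def])

lemma zero_in: "0 \<in> I" and compact_K: "compact K" and smooth_F: "smooth_on (I \<times> UNIV) F"
  and F_0: "F (0, t) = p + L t" and F_outside: "s \<in> I \<Longrightarrow> t \<notin> K \<Longrightarrow> F (s, t) = p + L t"
  using var by (auto simp: smooth_variation_def)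

lemma open_dom: "open (I \<times> (UNIV :: (real, 'k) vec set))"
  by (intro open_Times) auto

lemma smooth_derivs:
  "smooth_on (I \<times> UNIV) (Ft j)" "smooth_on (I \<times> UNIV) Fs" "smooth_on (I \<times> UNIV) (Fts j)"
  unfolding Fts_def Ft_def Fs_def by (intro smooth_on_dir_deriv smooth_F)+

lemmas cont_derivs =
  smooth_derivs [THEN smooth_on_imp_continuous_on] smooth_F [THEN smooth_on_imp_continuous_on]

lemma cont_W: "continuous_on (I \<times> UNIV) W"
  unfolding W_def [abs_def] by (intro continuous_on_wedge [OF card] cont_derivs)

lemma dir_deriv_slice:
  assumes "s \<in> I"
  shows "dir_deriv (axis j 1) (\<lambda>t. F (s, t)) t = Ft j (s, t)"
proof -
  have "((\<lambda>t. (s, t)) has_derivative (\<lambda>u. (0, u))) (at t)"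
    by (auto intro!: derivative_eq_intros)
  moreover have "(F has_derivative (\<lambda>v. dir_deriv v F (s, t))) (at (s, t))"
    by (intro has_derivative_dir_deriv smooth_on_imp_differentiable [OF smooth_F]) (use assms in simp)
  ultimately have "((\<lambda>t. F (s, t)) has_derivative (\<lambda>u. dir_deriv (0, u) F (s, t))) (at t)"
    by (rule has_derivative_compose)
  then show ?thesis unfolding Ft_def by (rule dir_deriv_eq)
qed

lemma dir_deriv_affine: "dir_deriv (axis j 1) (\<lambda>t. p + L t) t = v j"
proof -
  have "((\<lambda>t. p + L t) has_derivative L) (at t)"
    using bounded_linear_imp_has_derivative [of L "at t"] L(1)
    by (auto simp: linear_conv_bounded_linear intro!: derivative_eq_intros)
  then show ?thesis unfolding v_def by (rule dir_deriv_eq)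
qed

lemma Ft_0: "Ft j (0, t) = v j"
  using dir_deriv_slice [OF zero_in] dir_deriv_affine by (simp add: F_0)

text \<open>The complement of the compact set \<open>K\<close> is open, so agreement of the maps
  there passes to their derivatives.\<close>

lemma Ft_outside:
  assumes "s \<in> I" "t \<notin> K"
  shows "Ft j (s, t) = v j"
proof -
  have "dir_deriv (axis j 1) (\<lambda>t. F (s, t)) t = dir_deriv (axis j 1) (\<lambda>t. p + L t) t"
    by (rule dir_deriv_cong [of "- K"])
      (use assms compact_K in \<open>auto simp: F_outside compact_imp_closed\<close>)
  then show ?thesis using dir_deriv_slice assms(1) dir_deriv_affine by simp
qed

lemma W_0: "W (0, t) = a0"
  by (simp add: W_def Ft_0 a0_def)

lemma W_outside: "s \<in> I \<Longrightarrow> t \<notin> K \<Longrightarrow> W (s, t) = a0"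
  by (simp add: W_def Ft_outside a0_def)

lemma integral_over_slice:
  assumes "s \<in> I"
  shows "integral_over \<Phi> K (\<lambda>t. F (s, t)) = integral K (\<lambda>t. \<phi> (s, t))"
  by (simp add: integral_over_def \<phi>_def W_def dir_deriv_slice [OF assms])

lemma has_vector_derivative_slice:
  assumes "smooth_on (I \<times> UNIV) G" "s \<in> I"
  shows "((\<lambda>s. G (s, t)) has_vector_derivative dir_deriv (1, 0) G (s, t)) (at s)"
proof -
  have "((\<lambda>s. (s, t)) has_vector_derivative (1, 0)) (at s)"
    by (intro has_vector_derivative_Pair has_vector_derivative_id has_vector_derivative_const)
  then show ?thesis
    using smooth_on_imp_differentiable [OF assms(1)] assms(2)
    by (intro has_vector_derivative_dir_deriv) auto
qed

lemma \<phi>_has_derivative: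
  assumes "s \<in> I" "W (s, t) \<noteq> 0"
  shows "((\<lambda>s. \<phi> (s, t)) has_real_derivative \<phi>s (s, t)) (at s)"
proof -
  have "((\<lambda>s. W (s, t)) has_vector_derivative
      (\<Sum>j\<in>UNIV. wedge ((\<lambda>l. Ft l (s, t))(j := Fts j (s, t))))) (at s)"
    unfolding W_def [abs_def] Fts_def
    by (intro wedge_has_vector_derivative [OF card] has_vector_derivative_slice smooth_derivs assms)
  with has_vector_derivative_slice [OF smooth_F assms(1)]
  have "((\<lambda>s. (F (s, t), W (s, t))) has_vector_derivative
      (Fs (s, t), \<Sum>j\<in>UNIV. wedge ((\<lambda>l. Ft l (s, t))(j := Fts j (s, t))))) (at s)"
    unfolding Fs_def by (rule has_vector_derivative_Pair)
  from has_vector_derivative_dir_deriv [OF this differential_integrand_differentiable [OF \<Phi> assms(2)]]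
  show ?thesis
    by (simp add: has_real_derivative_iff_has_vector_derivative \<phi>_def \<phi>s_def)
qed

lemma cont_\<phi>s: "continuous_on {z \<in> I \<times> UNIV. W z \<noteq> 0} \<phi>s"
proof -
  let ?T = "{z \<in> I \<times> UNIV. W z \<noteq> 0}"
  have sub: "?T \<subseteq> I \<times> UNIV" by blast
  note cont = cont_derivs [THEN continuous_on_subset, OF sub] cont_W [THEN continuous_on_subset, OF sub]
  have "continuous_on ?T (\<lambda>z. wedge ((\<lambda>l. Ft l z)(j := Fts j z)))" for j
  proof -
    have "continuous_on ?T (if l = j then Fts j else Ft l)" for l using cont by auto
    from continuous_on_wedge [OF card this] show ?thesis
      by (simp add: fun_upd_def if_distribR cong: if_cong)
  qed
  then show ?thesis
    unfolding \<phi>s_def [abs_def]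
    by (intro continuous_on_dir_deriv_integrand [OF card \<Phi>] continuous_on_sum cont) auto
qed

text \<open>
  \<open>E j (s, \<cdot>)\<close> is the \<open>t\<^sub>j\<close>-derivative of the compactly supported function
  \<open>t \<mapsto> G j (F (s, t) - r t) t\<close>. Subtracting the \<open>E j\<close> from the integrand for every \<open>s\<close>, before
  differentiating in \<open>s\<close>, is an integration by parts that does not need the symmetry of the
  second derivatives of \<open>F\<close>.
\<close>

definition G :: "'k \<Rightarrow> (real, 'n) vec \<Rightarrow> (real, 'k) vec \<Rightarrow> real" where
  "G j u t = dir_deriv (0, wedge (v(j := u))) \<Phi> (p + L t, a0)"
definition H :: "'k \<Rightarrow> (real, 'n) vec \<Rightarrow> (real, 'k) vec \<Rightarrow> real" where
  "H j u t = dir_deriv (v j, 0) (dir_deriv (0, wedge (v(j := u))) \<Phi>) (p + L t, a0)"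
definition E :: "'k \<Rightarrow> real \<times> (real, 'k) vec \<Rightarrow> real" where
  "E j z = G j (Ft j z - v j) (snd z) + H j (F z - (p + L (snd z))) (snd z)"
definition Es :: "'k \<Rightarrow> real \<times> (real, 'k) vec \<Rightarrow> real" where
  "Es j z = G j (Fts j z) (snd z) + H j (Fs z) (snd z)"

section \<open>The correction terms \<open>E j\<close> and their integrals\<close>

lemma in_dom: "(x, a0) \<in> - (UNIV \<times> {0})"
  using a0_nonzero by simp

lemma linear_G: "linear (\<lambda>u. G j u t)"
proof -
  have "linear (\<lambda>u. (0, wedge (v(j := u))) :: (real, 'n) vec \<times> ('n, 'k) kvector)"
    using linear_wedge [of v j] by (simp add: linear_iff)
  from linear_compose [OF this linear_dir_deriv [OF differential_integrand_differentiable [OF \<Phi> a0_nonzero]]]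
  show ?thesis by (simp add: G_def o_def)
qed

lemma linear_H: "linear (\<lambda>u. H j u t)"
proof -
  have "linear (\<lambda>u. (0, wedge (v(j := u))) :: (real, 'n) vec \<times> ('n, 'k) kvector)"
    using linear_wedge [of v j] by (simp add: linear_iff)
  moreover have "smooth_on (- (UNIV \<times> {0})) \<Phi>" using \<Phi> by (simp add: differential_integrand_def)
  ultimately show ?thesis
    using linear_compose [OF _ linear_dir_deriv_dir_deriv [OF open_nonzero _ in_dom]]
    by (simp add: H_def [abs_def] o_def)
qed

lemma cont_L: "continuous_on S L"
  using L(1) by (simp add: linear_continuous_on linear_conv_bounded_linear)

lemma cont_GH: "continuous_on S (G j u)" "continuous_on S (H j u)"
proof -
  have "continuous_on S (\<lambda>t. (p + L t, a0))" by (intro continuous_intros cont_L)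
  then have "continuous_on S (\<lambda>t. f (p + L t, a0))" if "smooth_on (- (UNIV \<times> {0})) f"
    for f :: "(real, 'n) vec \<times> ('n, 'k) kvector \<Rightarrow> real"
    by (rule continuous_on_compose2 [OF smooth_on_imp_continuous_on [OF that]])
      (use a0_nonzero in auto)
  then show "continuous_on S (G j u)" "continuous_on S (H j u)"
    unfolding G_def [abs_def] H_def [abs_def]
    using differential_integrand_dir_deriv_smooth [OF \<Phi>] smooth_on_dir_deriv by blast+
qed

text \<open>\<open>G j\<close> and \<open>H j\<close> are linear in the first argument, so joint
  continuity reduces to the functions with \<open>axis m 1\<close> in its place.\<close>

lemma cont_GH_joint:
  assumes "continuous_on S u" "continuous_on S \<tau>"
  shows "continuous_on S (\<lambda>z. G j (u z) (\<tau> z))" "continuous_on S (\<lambda>z. H j (u z) (\<tau> z))"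
proof -
  have axis: "continuous_on S (\<lambda>z. G j (axis m 1) (\<tau> z))" "continuous_on S (\<lambda>z. H j (axis m 1) (\<tau> z))" for m
    by (auto intro: continuous_on_compose2 [OF cont_GH(1) assms(2) subset_UNIV]
        continuous_on_compose2 [OF cont_GH(2) assms(2) subset_UNIV])
  have *: "continuous_on S (\<lambda>z. \<Sum>m\<in>UNIV. u z $ m * G j (axis m 1) (\<tau> z))"
    "continuous_on S (\<lambda>z. \<Sum>m\<in>UNIV. u z $ m * H j (axis m 1) (\<tau> z))"
    by (intro continuous_intros assms axis)+
  show "continuous_on S (\<lambda>z. G j (u z) (\<tau> z))"
    using *(1) by (simp only: linear_expansion_real [OF linear_G, of _ "u _"])
  show "continuous_on S (\<lambda>z. H j (u z) (\<tau> z))"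
    using *(2) by (simp only: linear_expansion_real [OF linear_H, of _ "u _"])
qed

lemma cont_E: "continuous_on (I \<times> UNIV) (E j)"
  unfolding E_def [abs_def]
  by (intro continuous_on_add cont_GH_joint continuous_intros cont_derivs continuous_on_compose2 [OF cont_L]) auto

lemma cont_Es: "continuous_on (I \<times> UNIV) (Es j)"
  unfolding Es_def [abs_def]
  by (intro continuous_on_add cont_GH_joint continuous_intros cont_derivs)

lemma E_has_derivative:
  assumes "s \<in> I"
  shows "((\<lambda>s. E j (s, t)) has_real_derivative Es j (s, t)) (at s)"
proof -
  have G: "bounded_linear (\<lambda>u. G j u t)" and H: "bounded_linear (\<lambda>u. H j u t)"
    using linear_G linear_H by (simp_all flip: linear_conv_bounded_linear)
  have "((\<lambda>s. Ft j (s, t) - v j) has_vector_derivative Fts j (s, t)) (at s)"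
    using has_vector_derivative_diff [OF has_vector_derivative_slice [OF smooth_derivs(1) assms]
        has_vector_derivative_const] by (simp add: Fts_def)
  moreover have "((\<lambda>s. F (s, t) - (p + L t)) has_vector_derivative Fs (s, t)) (at s)"
    using has_vector_derivative_diff [OF has_vector_derivative_slice [OF smooth_F assms]
        has_vector_derivative_const] by (simp add: Fs_def)
  ultimately show ?thesis
    unfolding has_real_derivative_iff_has_vector_derivative E_def Es_def snd_conv
    by (intro has_vector_derivative_add bounded_linear.has_vector_derivative [OF G]
        bounded_linear.has_vector_derivative [OF H])
qed

lemma integral_E:
  assumes s: "s \<in> I" and K: "K \<subseteq> cbox a b"
  shows "integral (cbox a b) (\<lambda>t. E j (s, t)) = 0"
proof (rule integral_directional_derivative_eq_0 [where e = "axis j 1"])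
  let ?w = "\<lambda>t. G j (F (s, t) - (p + L t)) t"
  have slice: "continuous_on UNIV (\<lambda>t. f (s, t))" if "continuous_on (I \<times> UNIV) f"
    for f :: "real \<times> (real, 'k) vec \<Rightarrow> 'z::topological_space"
    using s by (intro continuous_on_compose2 [OF that] continuous_intros) auto
  show "continuous_on UNIV ?w"
    by (intro cont_GH_joint continuous_intros slice cont_derivs cont_L)
  show "continuous_on UNIV (\<lambda>t. E j (s, t))"
    by (intro slice cont_E)
  show "?w t = 0" "E j (s, t) = 0" if "t \<notin> cbox a b" for t
  proof -
    have "t \<notin> K" using that K by blast
    then show "?w t = 0" "E j (s, t) = 0"
      using F_outside [OF s] Ft_outside [OF s] linear_0 [OF linear_G] linear_0 [OF linear_H]
      by (simp_all add: E_def)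
  qed
  fix t :: "(real, 'k) vec"
  let ?\<gamma> = "\<lambda>h. t + h *\<^sub>R axis j 1"
  have \<gamma>: "(?\<gamma> has_vector_derivative axis j 1) (at 0)"
    by (auto intro!: derivative_eq_intros)
  have "((\<lambda>h. F (s, ?\<gamma> h)) has_vector_derivative Ft j (s, ?\<gamma> 0)) (at 0)"
    unfolding Ft_def
    using smooth_on_imp_differentiable [OF smooth_F] s
    by (intro has_vector_derivative_dir_deriv has_vector_derivative_Pair \<gamma>
        has_vector_derivative_const) auto
  moreover have aff: "((\<lambda>h. p + L (?\<gamma> h)) has_vector_derivative v j) (at 0)"
    using bounded_linear.has_vector_derivative [OF _ \<gamma>, of L] L(1)
      has_vector_derivative_add [OF has_vector_derivative_const]
    by (fastforce simp: v_def linear_conv_bounded_linear)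
  ultimately have "((\<lambda>h. F (s, ?\<gamma> h) - (p + L (?\<gamma> h))) has_vector_derivative Ft j (s, t) - v j) (at 0)"
    using has_vector_derivative_diff by fastforce
  from bounded_linear.has_vector_derivative [OF bounded_linear_vec_nth this]
  have D1: "((\<lambda>h. (F (s, ?\<gamma> h) - (p + L (?\<gamma> h))) $ m) has_real_derivative (Ft j (s, t) - v j) $ m) (at 0)" for m
    by (simp only: has_real_derivative_iff_has_vector_derivative)
  have "((\<lambda>h. (p + L (?\<gamma> h), a0)) has_vector_derivative (v j, 0)) (at 0)"
    by (intro has_vector_derivative_Pair aff has_vector_derivative_const)
  then have "((\<lambda>h. dir_deriv (0, wedge (v(j := axis m 1))) \<Phi> (p + L (?\<gamma> h), a0)) has_vector_derivative
      dir_deriv (v j, 0) (dir_deriv (0, wedge (v(j := axis m 1))) \<Phi>) (p + L (?\<gamma> 0), a0)) (at 0)" for m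
    by (rule has_vector_derivative_dir_deriv)
      (rule smooth_on_imp_differentiable [OF differential_integrand_dir_deriv_smooth [OF \<Phi>] in_dom])
  then have D2: "((\<lambda>h. G j (axis m 1) (?\<gamma> h)) has_real_derivative H j (axis m 1) t) (at 0)" for m
    by (simp add: has_real_derivative_iff_has_vector_derivative G_def H_def)
  \<comment> \<open>By linearity of \<open>G j\<close>, the function \<open>?w\<close> is a sum of
    products of real functions, to which the ordinary product rule applies.\<close>
  have "((\<lambda>h. \<Sum>m\<in>UNIV. (F (s, ?\<gamma> h) - (p + L (?\<gamma> h))) $ m * G j (axis m 1) (?\<gamma> h)) has_real_derivative
      (\<Sum>m\<in>UNIV. (Ft j (s, t) - v j) $ m * G j (axis m 1) (?\<gamma> 0) +
        H j (axis m 1) t * (F (s, ?\<gamma> 0) - (p + L (?\<gamma> 0))) $ m)) (at 0)"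
    by (intro DERIV_sum DERIV_mult D1 D2)
  moreover have "(\<Sum>m\<in>UNIV. (Ft j (s, t) - v j) $ m * G j (axis m 1) (?\<gamma> 0) +
        H j (axis m 1) t * (F (s, ?\<gamma> 0) - (p + L (?\<gamma> 0))) $ m) = E j (s, t)"
    unfolding E_def snd_conv sum.distrib
    by (subst linear_expansion_real [OF linear_G], subst linear_expansion_real [OF linear_H])
      (simp add: mult.commute)
  moreover have "?w (?\<gamma> h) =
      (\<Sum>m\<in>UNIV. (F (s, ?\<gamma> h) - (p + L (?\<gamma> h))) $ m * G j (axis m 1) (?\<gamma> h))" for h
    by (rule linear_expansion_real [OF linear_G])
  ultimately show "((\<lambda>h. ?w (?\<gamma> h)) has_real_derivative E j (s, t)) (at 0)"
    by simp
qed

section \<open>The first variation formula\<close>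

lemma cont_\<phi>: "continuous_on (I \<times> UNIV) \<phi>"
proof -
  have "continuous_on UNIV \<Phi>"
    using \<Phi> by (simp add: differential_integrand_def parametric_integrand_def)
  then show ?thesis
    unfolding \<phi>_def [abs_def]
    by (rule continuous_on_compose2) (auto intro: continuous_on_Pair cont_W cont_derivs)
qed

lemma \<phi>_outside: "s \<in> I \<Longrightarrow> t \<notin> K \<Longrightarrow> \<phi> (s, t) = \<phi> (0, t)"
  by (simp add: \<phi>_def F_outside W_outside F_0 W_0)

lemma continuous_slice:
  fixes f :: "real \<times> (real, 'k) vec \<Rightarrow> 'z::topological_space"
  assumes "continuous_on (I \<times> UNIV) f" "s \<in> I"
  shows "continuous_on S (\<lambda>t. f (s, t))"
  using assms(2) by (intro continuous_on_compose2 [OF assms(1)] continuous_intros) auto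

text \<open>The mixed derivatives \<open>Fts j\<close> enter both terms through the same
  \<open>G j\<close> and cancel; what remains involves only \<open>Fs\<close>, and
  \<open>euler_lagrange_hyperplane\<close> applies.\<close>

lemma \<phi>s_minus_Es_0:
  "\<phi>s (0, t) - (\<Sum>j\<in>UNIV. Es j (0, t)) =
    (\<Sum>i\<in>UNIV. Fs (0, t) $ i * hyper_coord i a0) * mixed_trace \<Phi> (p + L t, a0)"
proof -
  have lin: "linear (\<lambda>w. dir_deriv w \<Phi> (p + L t, a0))"
    by (rule linear_dir_deriv [OF differential_integrand_differentiable [OF \<Phi> a0_nonzero]])
  have Pair: "(Fs (0, t), \<Sum>j\<in>UNIV. wedge (v(j := Fts j (0, t)))) =
      (Fs (0, t), 0) + (\<Sum>j\<in>UNIV. (0, wedge (v(j := Fts j (0, t)))))"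
    by (simp add: sum_prod)
  have "\<phi>s (0, t) = dir_deriv (Fs (0, t), \<Sum>j\<in>UNIV. wedge (v(j := Fts j (0, t)))) \<Phi> (p + L t, a0)"
    by (simp add: \<phi>s_def F_0 W_0 Ft_0 fun_upd_def)
  also have "\<dots> = dir_deriv (Fs (0, t), 0) \<Phi> (p + L t, a0) + (\<Sum>j\<in>UNIV. G j (Fts j (0, t)) t)"
    unfolding Pair by (simp only: linear_add [OF lin] linear_sum [OF lin] G_def)
  finally have "\<phi>s (0, t) - (\<Sum>j\<in>UNIV. Es j (0, t)) =
      dir_deriv (Fs (0, t), 0) \<Phi> (p + L t, a0) - (\<Sum>j\<in>UNIV. H j (Fs (0, t)) t)"
    by (simp add: Es_def sum.distrib)
  then show ?thesis
    using euler_lagrange_hyperplane [OF card \<Phi> a0_nonzero a0_def, of "Fs (0, t)" "p + L t"]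
    by (simp add: H_def)
qed

text \<open>Since \<open>\<phi> (s, t) - \<phi> (0, t)\<close> vanishes off \<open>K\<close>, it has
  the same integral over \<open>K\<close> and over the box. The bracket collects the terms
  independent of \<open>s\<close>, and the \<open>E j\<close> integrate to 0.\<close>

lemma integral_over_eq:
  assumes s: "s \<in> I" and K: "K \<subseteq> cbox a b"
  shows "integral_over \<Phi> K (\<lambda>t. F (s, t)) =
    integral (cbox a b) (\<lambda>t. \<phi> (s, t) - (\<Sum>j\<in>UNIV. E j (s, t))) +
    (integral K (\<lambda>t. \<phi> (0, t)) - integral (cbox a b) (\<lambda>t. \<phi> (0, t)))"
proof -
  have int_K: "(\<lambda>t. \<phi> (s', t)) integrable_on K" if "s' \<in> I" for s'
    by (intro integrable_on_compact compact_K continuous_slice cont_\<phi> that)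
  have int_C: "(\<lambda>t. \<phi> (s', t)) integrable_on cbox a b" if "s' \<in> I" for s'
    by (intro integrable_continuous continuous_slice cont_\<phi> that)
  have int_E: "(\<lambda>t. E j (s, t)) integrable_on cbox a b" for j
    by (intro integrable_continuous continuous_slice cont_E s)
  have "((\<lambda>t. \<phi> (s, t) - \<phi> (0, t)) has_integral
      (integral K (\<lambda>t. \<phi> (s, t)) - integral K (\<lambda>t. \<phi> (0, t)))) K"
    by (intro has_integral_diff integrable_integral int_K s zero_in)
  then have "((\<lambda>t. \<phi> (s, t) - \<phi> (0, t)) has_integral
      (integral K (\<lambda>t. \<phi> (s, t)) - integral K (\<lambda>t. \<phi> (0, t)))) (cbox a b)"
    by (rule has_integral_on_superset) (use K \<phi>_outside [OF s] in auto)
  moreover have "((\<lambda>t. \<phi> (s, t) - \<phi> (0, t)) has_integral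
      (integral (cbox a b) (\<lambda>t. \<phi> (s, t)) - integral (cbox a b) (\<lambda>t. \<phi> (0, t)))) (cbox a b)"
    by (intro has_integral_diff integrable_integral int_C s zero_in)
  ultimately have "integral K (\<lambda>t. \<phi> (s, t)) - integral K (\<lambda>t. \<phi> (0, t)) =
      integral (cbox a b) (\<lambda>t. \<phi> (s, t)) - integral (cbox a b) (\<lambda>t. \<phi> (0, t))"
    by (rule has_integral_unique)
  moreover have "integral (cbox a b) (\<lambda>t. \<phi> (s, t) - (\<Sum>j\<in>UNIV. E j (s, t))) =
      integral (cbox a b) (\<lambda>t. \<phi> (s, t))"
    by (subst integral_diff [OF int_C [OF s] integrable_sum], simp, rule int_E,
        subst integral_sum, simp, rule int_E)
      (simp add: integral_E [OF s K])
  ultimately show ?thesis using integral_over_slice [OF s] by simp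
qed

lemma first_variation:
  assumes K: "K \<subseteq> cbox a b"
  shows "((\<lambda>s. integral_over \<Phi> K (\<lambda>t. F (s, t))) has_real_derivative
    integral (cbox a b) (\<lambda>t. (\<Sum>i\<in>UNIV. Fs (0, t) $ i * hyper_coord i a0) *
      mixed_trace \<Phi> (p + L t, a0))) (at 0)"
proof -
  \<comment> \<open>\<open>W\<close> equals the nonzero \<open>a0\<close> at \<open>s = 0\<close>;
    compactness of the box yields one neighbourhood of 0 on which \<open>W\<close> has no zero over
    the whole box.\<close>
  let ?O = "(I \<times> UNIV) \<inter> W -` (- {0})"
  have open_O: "open ?O" by (intro continuous_open_preimage [OF cont_W open_dom]) auto
  have sub_O: "{0} \<times> cbox a b \<subseteq> ?O" using zero_in a0_nonzero by (auto simp: W_0)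
  obtain X where X: "0 \<in> X" "open X" "X \<times> cbox a b \<subseteq> ?O"
    using Elementary_Topology.tube_lemma [OF compact_cbox open_O sub_O] by (elim exE conjE)
  then have "open (X \<inter> I)" "0 \<in> X \<inter> I" using zero_in by auto
  \<comment> \<open>A ball inside \<open>X \<inter> I\<close>, because the Leibniz rule is applied
    on a convex set of parameters.\<close>
  then obtain \<delta> where "\<delta> > 0" and \<delta>: "ball 0 \<delta> \<subseteq> X \<inter> I"
    by (metis open_contains_ball)
  let ?U = "ball (0 :: real) \<delta>"
  have zero_U: "0 \<in> ?U" using \<open>\<delta> > 0\<close> by simp
  have in_I: "s \<in> I" if "s \<in> ?U" for s using \<delta> that by blast
  have W: "W (s, t) \<noteq> 0" if "s \<in> ?U" "t \<in> cbox a b" for s t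
  proof -
    have "(s, t) \<in> X \<times> cbox a b" using \<delta> that by blast
    then show ?thesis using X(3) by blast
  qed
  have "((\<lambda>s. integral (cbox a b) (\<lambda>t. \<phi> (s, t) - (\<Sum>j\<in>UNIV. E j (s, t)))) has_real_derivative
      integral (cbox a b) (\<lambda>t. \<phi>s (0, t) - (\<Sum>j\<in>UNIV. Es j (0, t)))) (at 0 within ?U)"
  proof (rule leibniz_rule_field_derivative
      [where fx = "\<lambda>s t. \<phi>s (s, t) - (\<Sum>j\<in>UNIV. Es j (s, t))"])
    show "((\<lambda>s. \<phi> (s, t) - (\<Sum>j\<in>UNIV. E j (s, t))) has_real_derivative
        \<phi>s (s, t) - (\<Sum>j\<in>UNIV. Es j (s, t))) (at s within ?U)" if "s \<in> ?U" "t \<in> cbox a b" for s t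
      by (rule has_field_derivative_at_within)
        (intro DERIV_diff DERIV_sum \<phi>_has_derivative E_has_derivative in_I W that)
    show "(\<lambda>t. \<phi> (s, t) - (\<Sum>j\<in>UNIV. E j (s, t))) integrable_on cbox a b" if "s \<in> ?U" for s
      by (intro integrable_continuous continuous_on_diff continuous_on_sum continuous_slice
          cont_\<phi> cont_E in_I that)
    have "continuous_on (?U \<times> cbox a b) (\<lambda>z. \<phi>s z - (\<Sum>j\<in>UNIV. Es j z))"
    proof (intro continuous_on_diff continuous_on_sum)
      show "continuous_on (?U \<times> cbox a b) \<phi>s"
        by (rule continuous_on_subset [OF cont_\<phi>s]) (use in_I W in auto)
      show "continuous_on (?U \<times> cbox a b) (Es j)" for j
        by (rule continuous_on_subset [OF cont_Es]) (use in_I in auto)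
    qed
    then show "continuous_on (?U \<times> cbox a b) (\<lambda>(s, t). \<phi>s (s, t) - (\<Sum>j\<in>UNIV. Es j (s, t)))"
      by (simp add: case_prod_beta)
  qed (use zero_U in auto)
  then have "((\<lambda>s. integral (cbox a b) (\<lambda>t. \<phi> (s, t) - (\<Sum>j\<in>UNIV. E j (s, t)))) has_real_derivative
      integral (cbox a b) (\<lambda>t. \<phi>s (0, t) - (\<Sum>j\<in>UNIV. Es j (0, t)))) (at 0)"
    unfolding at_within_open [OF zero_U open_ball] .
  from DERIV_add [OF this DERIV_const
      [of "integral K (\<lambda>t. \<phi> (0, t)) - integral (cbox a b) (\<lambda>t. \<phi> (0, t))"]]
  have "((\<lambda>s. integral_over \<Phi> K (\<lambda>t. F (s, t))) has_real_derivative
      integral (cbox a b) (\<lambda>t. \<phi>s (0, t) - (\<Sum>j\<in>UNIV. Es j (0, t))) + 0) (at 0)"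
    by (rule has_field_derivative_transform_within_open [OF _ open_ball zero_U])
      (rule integral_over_eq [OF in_I K, symmetric])
  then show ?thesis by (simp add: \<phi>s_minus_Es_0)
qed

end

section \<open>The two implications\<close>

lemma projective_if_mixed_trace_0:
  fixes \<Phi> :: "(real, 'n::{finite,linorder}) vec \<times> ('n, 'k::{finite,linorder}) kvector \<Rightarrow> real"
  assumes card: "CARD('n) = Suc CARD('k)" and \<Phi>: "differential_integrand \<Phi>"
    and trace: "\<And>x a. a \<noteq> 0 \<Longrightarrow> mixed_trace \<Phi> (x, a) = 0"
  shows "projective \<Phi>"
  unfolding projective_def extremal_def
proof (intro conjI \<Phi> allI impI, elim conjE)
  fix p and L :: "(real, 'k) vec \<Rightarrow> (real, 'n) vec" and \<epsilon> K F
  assume "linear L" "inj L" "smooth_variation (\<lambda>t. p + L t) \<epsilon> K F"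
  then interpret hyperplane_variation \<Phi> p L \<epsilon> K F
    by (intro hyperplane_variation.intro card \<Phi>)
  obtain c where "K \<subseteq> cbox (- c) c"
    using bounded_subset_cbox_symmetric [OF compact_imp_bounded [OF compact_K]] by blast
  from first_variation [OF this]
  show "((\<lambda>s. integral_over \<Phi> K (\<lambda>t. F (s, t))) has_real_derivative 0) (at 0)"
    by (simp add: trace a0_nonzero)
qed

lemma cont_mixed_trace:
  fixes \<Phi> :: "(real, 'n::{finite,linorder}) vec \<times> ('n, 'k::{finite,linorder}) kvector \<Rightarrow> real"
  assumes "differential_integrand \<Phi>"
  shows "continuous_on (- (UNIV \<times> {0})) (mixed_trace \<Phi>)"
  unfolding mixed_trace_def [abs_def]
  by (intro continuous_on_sum smooth_on_imp_continuous_on smooth_on_dir_deriv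
      differential_integrand_dir_deriv_smooth assms)

text \<open>The bump is positive exactly for \<open>norm t < \<rho>\<close>. Its argument is written
  as a sum with an inner product so that the rules for sums and bilinear products apply.\<close>

lemma smooth_variation_bump:
  fixes L :: "(real, 'k::finite) vec \<Rightarrow> (real, 'n::finite) vec"
  assumes "linear L" "\<rho> \<ge> 0"
  shows "smooth_variation (\<lambda>t. x + L t) 1 (cball 0 \<rho>)
    (\<lambda>z. (x + L (snd z)) + (fst z * flat_exp 0 (\<rho>\<^sup>2 + (- snd z) \<bullet> snd z)) *\<^sub>R u)"
proof -
  have L: "bounded_linear (\<lambda>z :: real \<times> (real, 'k) vec. L (snd z))"
    using bounded_linear_compose [OF _ bounded_linear_snd, of L] assms
    by (simp add: linear_conv_bounded_linear)
  have "smooth_on S (\<lambda>z. (x + L (snd z)) + (fst z * flat_exp 0 (\<rho>\<^sup>2 + (- snd z) \<bullet> snd z)) *\<^sub>R u)"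
    if S: "open S" for S :: "(real \<times> (real, 'k) vec) set"
  proof -
    have "smooth_on S (\<lambda>z. (- snd z) \<bullet> snd z)"
      by (intro bounded_bilinear.smooth_on_prod [OF bounded_bilinear_inner S] smooth_on_bounded_linear
          bounded_linear_minus bounded_linear_snd)
    then have "smooth_on S (\<lambda>z. \<rho>\<^sup>2 + (- snd z) \<bullet> snd z)"
      by (rule smooth_on_add [OF S smooth_on_const])
    then have "smooth_on S (\<lambda>z. flat_exp 0 (\<rho>\<^sup>2 + (- snd z) \<bullet> snd z))"
      by (rule smooth_on_compose_real [OF S smooth_on_flat_exp])
    then have "smooth_on S (\<lambda>z. fst z * flat_exp 0 (\<rho>\<^sup>2 + (- snd z) \<bullet> snd z))"
      by (rule bounded_bilinear.smooth_on_prod [OF bounded_bilinear_mult S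
            smooth_on_bounded_linear [OF bounded_linear_fst]])
    then show ?thesis
      by (intro smooth_on_add [OF S] smooth_on_const smooth_on_bounded_linear [OF L]
          bounded_bilinear.smooth_on_prod [OF bounded_bilinear_scaleR S])
  qed
  moreover have "flat_exp 0 (\<rho>\<^sup>2 - t \<bullet> t) = 0" if "t \<notin> cball 0 \<rho>" for t :: "(real, 'k) vec"
  proof -
    have "\<rho>\<^sup>2 < (norm t)\<^sup>2" using that assms(2) by (intro power_strict_mono) auto
    then show ?thesis by (simp add: flat_exp_def power2_norm_eq_inner)
  qed
  ultimately show ?thesis
    by (auto simp: smooth_variation_def open_Times)
qed

lemma mixed_trace_0_if_projective:
  fixes \<Phi> :: "(real, 'n::{finite,linorder}) vec \<times> ('n, 'k::{finite,linorder}) kvector \<Rightarrow> real"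
  assumes card: "CARD('n) = Suc CARD('k)" and proj: "projective \<Phi>" and a: "a \<noteq> 0"
  shows "mixed_trace \<Phi> (x, a) = 0"
proof (rule ccontr)
  assume nz: "mixed_trace \<Phi> (x, a) \<noteq> 0"
  have \<Phi>: "differential_integrand \<Phi>" using proj by (simp add: projective_def)
  obtain w :: "'k \<Rightarrow> (real, 'n) vec" where w: "wedge w = a" using wedge_surj [OF card a] by blast
  define L where "L t = (\<Sum>j\<in>UNIV. t $ j *\<^sub>R w j)" for t :: "(real, 'k) vec"
  have lin: "linear L"
    by (rule linearI) (simp_all add: L_def scaleR_add_left sum.distrib scaleR_sum_right)
  have inj: "inj L" using inj_if_wedge_nonzero [of w] w a by (simp add: L_def [abs_def])
  have L_axis: "L (axis j 1) = w j" for j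
    by (simp add: L_def axis_def if_distrib [of "\<lambda>c. c *\<^sub>R _"] cong: if_cong)
  obtain i where i: "hyper_coord i a \<noteq> 0"
    using hyper_coord_eqI [OF card, of a 0] a by auto
  define m where "m t = mixed_trace \<Phi> (x + L t, a)" for t
  have cont_m: "continuous_on UNIV m"
  proof -
    have "continuous_on UNIV (\<lambda>t. (x + L t, a))"
      using lin by (intro continuous_intros linear_continuous_on) (simp add: linear_conv_bounded_linear)
    then show ?thesis
      unfolding m_def [abs_def]
      by (rule continuous_on_compose2 [OF cont_mixed_trace [OF \<Phi>]]) (use a in auto)
  qed
  have m0: "m 0 = mixed_trace \<Phi> (x, a)" by (simp add: m_def linear_0 [OF lin])
  \<comment> \<open>The set where \<open>m\<close> has the sign of \<open>m 0\<close>; the support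
    of the bump is placed inside it.\<close>
  have "open {t. 0 < m t * m 0}"
    by (intro open_Collect_less continuous_intros cont_m)
  moreover have "0 \<in> {t. 0 < m t * m 0}" using nz m0 by (simp add: zero_less_mult_iff) linarith
  ultimately obtain \<rho> where "\<rho> > 0" and \<rho>: "cball 0 \<rho> \<subseteq> {t. 0 < m t * m 0}"
    by (metis open_contains_cball)
  define \<eta> where "\<eta> t = flat_exp 0 (\<rho>\<^sup>2 + (- t) \<bullet> t)" for t :: "(real, 'k) vec"
  define F where "F z = (x + L (snd z)) + (fst z * \<eta> (snd z)) *\<^sub>R axis i 1"
    for z :: "real \<times> (real, 'k) vec"
  have var: "smooth_variation (\<lambda>t. x + L t) 1 (cball 0 \<rho>) F"
    using smooth_variation_bump [OF lin] \<open>\<rho> > 0\<close> by (simp add: F_def [abs_def] \<eta>_def)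
  interpret hyperplane_variation \<Phi> x L 1 "cball 0 \<rho>" F
    by (intro hyperplane_variation.intro card \<Phi> lin inj var)
  have a0: "a0 = a" using w by (simp add: a0_def v_def [abs_def] L_axis)
  have Fs: "Fs (0, t) = \<eta> t *\<^sub>R axis i 1" for t
  proof -
    have "((\<lambda>s. F (s, t)) has_vector_derivative Fs (0, t)) (at 0)"
      unfolding Fs_def by (rule has_vector_derivative_slice [OF smooth_F zero_in])
    moreover have "((\<lambda>s. F (s, t)) has_vector_derivative \<eta> t *\<^sub>R axis i 1) (at 0)"
      unfolding F_def by (auto intro!: derivative_eq_intros)
    ultimately show ?thesis by (rule vector_derivative_unique_at)
  qed
  have sum: "(\<Sum>i'\<in>UNIV. Fs (0, t) $ i' * hyper_coord i' a0) = \<eta> t * hyper_coord i a" for t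
    by (simp add: Fs a0 axis_def if_distrib [of "\<lambda>c. c * _"] if_distrib [of "\<lambda>c. _ * c"] cong: if_cong)
  \<comment> \<open>An open box around the ball, since the vanishing theorem for \<open>g\<close>
    below asks for a nonempty interior.\<close>
  obtain c :: "(real, 'k) vec" where c: "cball 0 \<rho> \<subseteq> box (- c) c"
    using bounded_subset_box_symmetric [OF bounded_cball] by blast
  then have c': "cball 0 \<rho> \<subseteq> cbox (- c) c" using box_subset_cbox by blast
  define f where "f t = (\<eta> t * hyper_coord i a) * m t" for t
  \<comment> \<open>The constant factor fixes the sign: \<open>g t\<close> is
    \<open>\<eta> t\<close> times a square times \<open>m t * m 0\<close>.\<close>
  define g where "g t = f t * (hyper_coord i a * m 0)" for t
  have cont_\<eta>: "continuous_on S \<eta>" for S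
    unfolding \<eta>_def [abs_def]
    by (intro continuous_on_compose2 [OF smooth_on_imp_continuous_on [OF smooth_on_flat_exp]]
        continuous_intros) auto
  have cont_f: "continuous_on S f" for S
    unfolding f_def [abs_def]
    by (intro continuous_intros cont_\<eta> continuous_on_subset [OF cont_m]) auto
  have "((\<lambda>s. integral_over \<Phi> (cball 0 \<rho>) (\<lambda>t. F (s, t))) has_real_derivative integral (cbox (- c) c) f) (at 0)"
    using first_variation [OF c'] unfolding sum f_def [abs_def] by (simp add: m_def a0)
  moreover have "((\<lambda>s. integral_over \<Phi> (cball 0 \<rho>) (\<lambda>t. F (s, t))) has_real_derivative 0) (at 0)"
    using proj lin inj var unfolding projective_def extremal_def by blast
  ultimately have "integral (cbox (- c) c) f = 0" by (rule DERIV_unique)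
  then have "(f has_integral 0) (cbox (- c) c)"
    using integrable_integral [OF integrable_continuous [OF cont_f]] by metis
  from has_integral_mult_left [OF this, of "hyper_coord i a * m 0"]
  have g_int: "(g has_integral 0) (cbox (- c) c)" by (simp add: g_def [abs_def])
  have "g 0 = 0"
  proof (rule has_integral_0_cbox_imp_0 [OF _ _ g_int])
    show "continuous_on (cbox (- c) c) g"
      unfolding g_def [abs_def] by (intro continuous_intros cont_f)
    show "0 \<le> g t" for t
    proof (cases "t \<in> cball 0 \<rho>")
      case True
      then have "0 < m t * m 0" using \<rho> by blast
      moreover have "g t = \<eta> t * (hyper_coord i a)\<^sup>2 * (m t * m 0)"
        by (simp add: g_def f_def power2_eq_square)
      moreover have "0 \<le> \<eta> t" by (simp add: \<eta>_def flat_exp_def)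
      ultimately show ?thesis by simp
    next
      case False
      \<comment> \<open>Any nonzero parameter in (-1, 1) serves: where the variation does not move
        the point, the bump vanishes.\<close>
      then have "F (1 / 2, t) = x + L t" by (intro F_outside) auto
      then have "\<eta> t = 0" by (simp add: F_def)
      then show ?thesis by (simp add: g_def f_def)
    qed
    have "0 \<in> cball (0 :: (real, 'k) vec) \<rho>" using \<open>\<rho> > 0\<close> by simp
    then show "box (- c) c \<noteq> {}" "0 \<in> cbox (- c) c" using c c' by blast+
  qed
  moreover have "\<eta> 0 > 0" using \<open>\<rho> > 0\<close> by (simp add: \<eta>_def flat_exp_def)
  ultimately show False using i nz m0 by (simp add: g_def f_def)
qed

theorem corollary4p4:
  fixes \<Phi> :: "(real ^ 'n::{finite,linorder}) \<times> ('n, 'k::{finite,linorder}) kvector \<Rightarrow> real"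
  assumes "CARD('n) \<ge> 2" and "CARD('k) = CARD('n) - 1"
    and "differential_integrand \<Phi>"
  shows "projective \<Phi> \<longleftrightarrow>
    (\<forall>x a. a \<noteq> 0 \<longrightarrow>
      (\<Sum>i\<in>UNIV. dir_deriv (axis i 1, 0) (dir_deriv (0, hyper_basis i) \<Phi>) (x, a)) = 0)"
proof -
  have card: "CARD('n) = Suc CARD('k)" using assms(1,2) by simp
  show ?thesis
    using projective_if_mixed_trace_0 [OF card assms(3)] mixed_trace_0_if_projective [OF card]
    unfolding mixed_trace_def by blast
qed

end
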